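(* Let $(Y,d)$ be a complete metric space equipped with a doubling measure $\nu$, let $x_0\in Y$, and assume that $Y$ is uniformly perfect at $x_0$. Write $B_\rho=B(x_0,\rho)$. Let $1\le p<\infty$ and $0<\theta<1$. (a) If $\theta p>\overline s_0$, then $C_{\theta,p}(\{x_0\})>0$ and $\operatorname{cap}_{\theta,p}(\{x_0\},B_R)>0$ for every $0<R<\tfrac12\operatorname{diam}Y$. (b) If $\theta p\notin\overline S_0$ (in particular if $\theta p<\overline s_0$), or if $p>1$ and $\theta p\in\underline S_0$, then $C_{\theta,p}(\{x_0\})=0$ and $\operatorname{cap}_{\theta,p}(\{x_0\},B_R)=0$ for every $R>0$.
   Context: All metric spaces contain at least two points. $B(x,r)=\{y:d(x,y)<r\}$ are open balls. $\nu$ is a Borel measure with $0<\nu(B)<\infty$ for every ball, and it is doubling: there is $C_\nu>1$ such that $\nu(B(x,2r))\le C_\nu\,\nu(B(x,r))$ for all $x\in Y$, $r>0$. $Y$ is uniformly perfect at $x_0$ if there is a constant $\kappa>1$ such that $B(x_0,\kappa r)\setminus B(x_0,r)\ne\varnothing$ whenever $B(x_0,\kappa r)\ne Y$. Exponent sets (at $x_0$): $\underline S_0$ is the set of $s>0$ for which there is $C>0$ with $\nu(B_r)\le Cr^s$ for all $0<r\le1$; $\overline S_0$ is the set of $s>0$ for which there is $c>0$ with $\nu(B_r)\ge cr^s$ for all $0<r\le1$; $\overline s_0=\inf\overline S_0$. $E\Subset\Omega$ means that $\overline E$ is a compact subset of $\Omega$. The Besov seminorm of a measurable function $u$ is $$[u]_{\theta,p}=\biggl(\int_Y\int_Y\frac{|u(x)-u(y)|^p}{d(x,y)^{\theta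 p}}\frac{d\nu(y)\,d\nu(x)}{\nu(B(x,d(x,y)))}\biggr)^{1/p},$$ the integrand being interpreted as $0$ when $x=y$. The Besov norm-capacity of $E\subset Y$ is $C_{\theta,p}(E)=\inf_u\bigl([u]_{\theta,p}^p+\|u\|_{L^p(Y)}^p\bigr)$, the infimum being over all $u$ with finite value of this expression such that $u=1$ in a neighbourhood of $E$ and $0\le u\le1$ everywhere. For a bounded open set $\Omega\subset Y$ and $E\Subset\Omega$, the Besov condenser capacity is $\operatorname{cap}_{\theta,p}(E,\Omega)=\inf_u[u]_{\theta,p}^p$, the infimum being over all $u$ such that $0\le u\le1$ everywhere, $u=1$ in a neighbourhood of $E$ and $\operatorname{supp}u\Subset\Omega$. *)

theory Defs
  imports "HOL-Analysis.Analysis"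
begin

text \<open>
  The metric space \<open>Y\<close> is the whole carrier type. All capacities and integrals take values in
  \<^typ>\<open>ennreal\<close>, so an infimum over the empty set is \<open>\<infinity>\<close>.
\<close>

definition borel_measure_pos_balls :: "'a::metric_space measure \<Rightarrow> bool" where
  "borel_measure_pos_balls \<nu> \<longleftrightarrow>
     sets \<nu> = sets borel \<and>
     (\<forall>x r. 0 < r \<longrightarrow> 0 < emeasure \<nu> (ball x r) \<and> emeasure \<nu> (ball x r) < \<infinity>)"

definition doubling_measure :: "'a::metric_space measure \<Rightarrow> bool" where
  "doubling_measure \<nu> \<longleftrightarrow>
     borel_measure_pos_balls \<nu> \<and>
     (\<exists>C>1. \<forall>x r. 0 < r \<longrightarrow> measure \<nu> (ball x (2 * r)) \<le> C * measure \<nu> (ball x r))"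

definition uniformly_perfect_at :: "'a::metric_space \<Rightarrow> bool" where
  "uniformly_perfect_at x0 \<longleftrightarrow>
     (\<exists>\<kappa>>1. \<forall>r>0. ball x0 (\<kappa> * r) \<noteq> UNIV \<longrightarrow> ball x0 (\<kappa> * r) - ball x0 r \<noteq> {})"

definition lower_S :: "'a::metric_space measure \<Rightarrow> 'a \<Rightarrow> real set" where
  "lower_S \<nu> x0 =
     {s. 0 < s \<and> (\<exists>C>0. \<forall>r. 0 < r \<and> r \<le> 1 \<longrightarrow> measure \<nu> (ball x0 r) \<le> C * r powr s)}"

definition upper_S :: "'a::metric_space measure \<Rightarrow> 'a \<Rightarrow> real set" where
  "upper_S \<nu> x0 =
     {s. 0 < s \<and> (\<exists>c>0. \<forall>r. 0 < r \<and> r \<le> 1 \<longrightarrow> c * r powr s \<le> measure \<nu> (ball x0 r))}"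

definition upper_s :: "'a::metric_space measure \<Rightarrow> 'a \<Rightarrow> ereal" where
  "upper_s \<nu> x0 = Inf (ereal ` upper_S \<nu> x0)"

text \<open>
  The library's \<^const>\<open>diameter\<close> is \<open>0\<close> on unbounded sets; here the diameter of an
  unbounded set is \<open>\<infinity>\<close>.
\<close>

definition ediameter :: "'a::metric_space set \<Rightarrow> ereal" where
  "ediameter A = (SUP x\<in>A. SUP y\<in>A. ereal (dist x y))"

text \<open>Real powers on \<open>[0, \<infinity>]\<close>, used only for exponents \<open>a > 0\<close>.\<close>

definition ennreal_powr :: "ennreal \<Rightarrow> real \<Rightarrow> ennreal" where
  "ennreal_powr t a = (if t = \<infinity> then \<infinity> else ennreal (enn2real t powr a))"

definition besov_seminorm ::
    "'a::metric_space measure \<Rightarrow> real \<Rightarrow> real \<Rightarrow> ('a \<Rightarrow> real) \<Rightarrow> ennreal" where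
  "besov_seminorm \<nu> \<theta> p u =
     ennreal_powr
       (\<integral>\<^sup>+x. (\<integral>\<^sup>+y.
          (if x = y then 0
           else ennreal (\<bar>u x - u y\<bar> powr p / dist x y powr (\<theta> * p)
                         / measure \<nu> (ball x (dist x y)))) \<partial>\<nu>) \<partial>\<nu>)
       (1 / p)"

definition Lp_norm :: "'a measure \<Rightarrow> real \<Rightarrow> ('a \<Rightarrow> real) \<Rightarrow> ennreal" where
  "Lp_norm \<nu> p u = ennreal_powr (\<integral>\<^sup>+x. ennreal (\<bar>u x\<bar> powr p) \<partial>\<nu>) (1 / p)"

definition one_near :: "'a::topological_space set \<Rightarrow> ('a \<Rightarrow> real) \<Rightarrow> bool" where
  "one_near E u \<longleftrightarrow> (\<exists>G. open G \<and> E \<subseteq> G \<and> (\<forall>x\<in>G. u x = 1))"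

definition compactly_inside :: "'a::topological_space set \<Rightarrow> 'a set \<Rightarrow> bool"
    (infix "\<Subset>" 50) where
  "E \<Subset> \<Omega> \<longleftrightarrow> compact (closure E) \<and> closure E \<subseteq> \<Omega>"

definition supp :: "('a::topological_space \<Rightarrow> real) \<Rightarrow> 'a set" where
  "supp u = closure {x. u x \<noteq> 0}"

definition besov_norm_capacity ::
    "'a::metric_space measure \<Rightarrow> real \<Rightarrow> real \<Rightarrow> 'a set \<Rightarrow> ennreal" where
  "besov_norm_capacity \<nu> \<theta> p E =
     Inf {ennreal_powr (besov_seminorm \<nu> \<theta> p u) p + ennreal_powr (Lp_norm \<nu> p u) p | u.
            u \<in> borel_measurable \<nu> \<and>
            ennreal_powr (besov_seminorm \<nu> \<theta> p u) p + ennreal_powr (Lp_norm \<nu> p u) p < \<infinity> \<and>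
            one_near E u \<and> (\<forall>x. 0 \<le> u x \<and> u x \<le> 1)}"

text \<open>Meaningful for bounded open \<open>\<Omega>\<close> and \<open>E \<Subset> \<Omega>\<close>.\<close>

definition besov_condenser_capacity ::
    "'a::metric_space measure \<Rightarrow> real \<Rightarrow> real \<Rightarrow> 'a set \<Rightarrow> 'a set \<Rightarrow> ennreal" where
  "besov_condenser_capacity \<nu> \<theta> p E \<Omega> =
     Inf {ennreal_powr (besov_seminorm \<nu> \<theta> p u) p | u.
            u \<in> borel_measurable \<nu> \<and> (\<forall>x. 0 \<le> u x \<and> u x \<le> 1) \<and>
            one_near E u \<and> supp u \<Subset> \<Omega>}"

end

theory Submission
  imports Defs
begin

text \<open>
  Positivity: if \<open>u = 1\<close> near \<open>x0\<close>, the averages of \<open>u\<close> over the balls \<open>B(x0, 2\<^sup>-\<^sup>k)\<close> tend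
  to \<open>1\<close>. Instead of the Poincare inequality with \<open>p\<close>-th roots we use
  \<open>t \<le> l + l\<^sup>1\<^sup>-\<^sup>p t\<^sup>p\<close>, so that consecutive averages differ by at most
  \<open>l + const l\<^sup>1\<^sup>-\<^sup>p 2\<^sup>-\<^sup>k\<^sup>(\<^sup>\<theta>\<^sup>p\<^sup>-\<^sup>s\<^sup>) [u]\<^sup>p\<close> when \<open>\<nu>(B\<^sub>r) \<ge> c r\<^sup>s\<close>. Letting \<open>l\<close> decay
  geometrically in \<open>k\<close> makes the sum over all scales finite, and the energy cannot be small unless
  the average of \<open>u\<close> over a fixed ball is close to \<open>1\<close>.

  Vanishing: the logarithmic cutoff \<open>u\<close> between the radii \<open>\<rho> < r\<close> satisfies
  \<open>\<bar>u x - u y\<bar> \<le> ln (1 + d(x,y) / max \<rho> (d(x0,x))) / ln (r/\<rho>)\<close> if \<open>x\<close> is the point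
  nearer to \<open>x0\<close>. Integrating in \<open>y\<close> over dyadic annuli bounds its energy by
  \<open>ln (r/\<rho>)\<^sup>-\<^sup>p\<close> times the integral of \<open>max \<rho> (d(x0,x))\<^sup>-\<^sup>\<theta>\<^sup>p\<close> over \<open>B\<^sub>r\<close>. With
  \<open>\<rho> = r/2\<close> this is \<open>const \<nu>(B\<^sub>r) r\<^sup>-\<^sup>\<theta>\<^sup>p\<close>, and with \<open>\<rho> = 2\<^sup>-\<^sup>N r\<close> and
  \<open>\<nu>(B\<^sub>r) \<le> M r\<^sup>\<theta>\<^sup>p\<close> it is \<open>const N\<^sup>1\<^sup>-\<^sup>p\<close>.
\<close>

section \<open>Elementary facts on real powers and dyadic scales\<close>

text \<open>Both norms carry a p-th root that the capacities undo at once; this removes the pair,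
  also at the value infinity.\<close>

lemma ennreal_powr_powr_inverse:
  assumes "0 < p"
  shows "ennreal_powr (ennreal_powr t (1 / p)) p = t"
  using assms by (cases t) (auto simp: ennreal_powr_def powr_powr)

lemma ex_dyadic_ge_one:
  fixes t :: real
  assumes "1 \<le> t"
  shows "\<exists>i. 2 ^ i \<le> t \<and> t < 2 ^ Suc i"
proof -
  have ex: "\<exists>n. t < 2 ^ n" by (simp add: real_arch_pow)
  define n where "n = (LEAST n. t < 2 ^ n)"
  have n: "t < 2 ^ n" unfolding n_def using ex by (rule LeastI_ex)
  have "n \<noteq> 0" using n assms by (cases n) auto
  then obtain i where i: "n = Suc i" using not0_implies_Suc by blast
  have "\<not> t < 2 ^ i"
    using not_less_Least[of i "\<lambda>n. t < 2 ^ n"] i n_def by simp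
  then show ?thesis using n i by (intro exI[of _ i]) auto
qed

text \<open>Differs from the previous lemma in which end is closed. Applied to
  \<open>m / dist x y\<close>, the reciprocal turns this into annuli that contain their inner
  radius.\<close>

lemma ex_dyadic_gt_one:
  fixes t :: real
  assumes "1 < t"
  shows "\<exists>i. 2 ^ i < t \<and> t \<le> 2 ^ Suc i"
proof -
  have "\<exists>n. t < 2 ^ n" by (simp add: real_arch_pow)
  then have ex: "\<exists>n. t \<le> 2 ^ n" using less_imp_le by blast
  define n where "n = (LEAST n. t \<le> 2 ^ n)"
  have n: "t \<le> 2 ^ n" unfolding n_def using ex by (rule LeastI_ex)
  have "n \<noteq> 0" using n assms by (cases n) auto
  then obtain i where i: "n = Suc i" using not0_implies_Suc by blast
  have "\<not> t \<le> 2 ^ i"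
    using not_less_Least[of i "\<lambda>n. t \<le> 2 ^ n"] i n_def by simp
  then show ?thesis using n i by (intro exI[of _ i]) auto
qed

text \<open>If \<open>t > l\<close>, then \<open>(t / l) powr (p - 1)\<close> is at least 1 and
  multiplying by it only enlarges \<open>t\<close>. The free parameter \<open>l\<close> takes the
  place of Jensen's inequality, so averages can be compared with p-th powers without taking
  roots.\<close>

lemma le_add_powr:
  fixes t l p :: real
  assumes "0 \<le> t" "0 < l" "1 \<le> p"
  shows "t \<le> l + l powr (1 - p) * t powr p"
proof (cases "t \<le> l")
  case True
  then show ?thesis using assms by (simp add: add_increasing2)
next
  case False
  then have "1 \<le> (t / l) powr (p - 1)"
    using assms by (intro ge_one_powr_ge_zero) (auto simp: divide_simps)
  then have "t * 1 \<le> t * (t / l) powr (p - 1)"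
    using assms by (intro mult_left_mono) auto
  also have "\<dots> = l powr (1 - p) * t powr p"
    using False assms
    by (simp add: powr_divide powr_diff divide_simps)
  finally show ?thesis using assms by simp
qed

subsection \<open>Doubling measures\<close>

locale doubling_space =
  fixes \<nu> :: "'a::metric_space measure" and C :: real
  assumes sets_eq: "sets \<nu> = sets borel"
    and ball_pos: "0 < r \<Longrightarrow> 0 < emeasure \<nu> (ball x r)"
    and ball_fin: "0 < r \<Longrightarrow> emeasure \<nu> (ball x r) < \<infinity>"
    and C_gt_1: "1 < C"
    and doubling: "0 < r \<Longrightarrow> measure \<nu> (ball x (2 * r)) \<le> C * measure \<nu> (ball x r)"
begin

abbreviation V :: "'a \<Rightarrow> real \<Rightarrow> real" where "V x r \<equiv> measure \<nu> (ball x r)"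

lemma space_eq [simp]: "space \<nu> = UNIV"
  using sets_eq_imp_space_eq[OF sets_eq] by simp

lemma measurable_eq: "borel_measurable \<nu> = borel_measurable borel"
  by (rule measurable_cong_sets[OF sets_eq refl])

lemma ball_sets [measurable, simp]: "ball x r \<in> sets \<nu>"
  by (simp add: sets_eq)

lemma dist_measurable [measurable]: "(\<lambda>y. dist x y) \<in> borel_measurable \<nu>"
  unfolding measurable_eq by (intro borel_measurable_continuous_onI continuous_intros)

lemma emeasure_ball: "emeasure \<nu> (ball x r) = ennreal (V x r)"
proof (cases "0 < r")
  case True
  then show ?thesis using ball_fin[of r x] by (intro emeasure_eq_ennreal_measure) auto
next
  case False
  then have "ball x r = {}" by simp
  then show ?thesis by (simp only:) simp
qed

lemma V_pos: "0 < r \<Longrightarrow> 0 < V x r"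
  using ball_pos[of r x] by (simp add: emeasure_ball)

lemma V_mono: "ball x r \<subseteq> ball y s \<Longrightarrow> V x r \<le> V y s"
  using emeasure_mono[of "ball x r" "ball y s" \<nu>]
  by (simp add: emeasure_ball)

text \<open>The Besov kernel weighs a pair by a ball centred at its first point; this makes the
  kernel symmetric up to a factor.\<close>

lemma V_centre_swap:
  assumes "x \<noteq> y"
  shows "V y (dist x y) \<le> C * V x (dist x y)"
proof -
  have "ball y (dist x y) \<subseteq> ball x (2 * dist x y)"
  proof
    fix z assume "z \<in> ball y (dist x y)"
    then show "z \<in> ball x (2 * dist x y)"
      using dist_triangle[of x z y] by simp
  qed
  then have "V y (dist x y) \<le> V x (2 * dist x y)" by (rule V_mono)
  also have "\<dots> \<le> C * V x (dist x y)" using assms by (intro doubling) simp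
  finally show ?thesis .
qed

lemma V_iterate: "0 < r \<Longrightarrow> V x (2 ^ n * r) \<le> C ^ n * V x r"
proof (induction n)
  case (Suc n)
  have "V x (2 ^ Suc n * r) \<le> C * V x (2 ^ n * r)"
    using doubling[of "2 ^ n * r" x] Suc.prems by (simp add: mult.assoc)
  also have "\<dots> \<le> C * (C ^ n * V x r)" using Suc C_gt_1 by (intro mult_left_mono) auto
  finally show ?case by (simp add: mult.assoc)
qed simp

lemma sigma_finite: "sigma_finite_measure \<nu>"
proof
  show "\<exists>A. countable A \<and> A \<subseteq> sets \<nu> \<and> \<Union> A = space \<nu> \<and> (\<forall>a\<in>A. emeasure \<nu> a \<noteq> \<infinity>)"
  proof (intro exI[of _ "range (\<lambda>n::nat. ball undefined (real n))"] conjI)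
    show "\<Union> (range (\<lambda>n::nat. ball undefined (real n))) = space \<nu>"
      by (auto intro: reals_Archimedean2)
  qed (auto simp: emeasure_ball)
qed

section \<open>Total boundedness, separability and joint measurability\<close>

text \<open>Balls of radius \<open>e / 2\<close> around an e-separated set are disjoint, lie in one
  fixed ball, and by doubling have mass bounded below. Hence the cardinality of such sets is
  bounded, and one of maximal cardinality is a net, since an uncovered point could be added to
  it.\<close>

lemma finite_net:
  fixes x0 :: 'a
  assumes "0 < e"
  shows "\<exists>k. finite k \<and> cball x0 R \<subseteq> (\<Union>x\<in>k. ball x e)"
proof -
  \<comment> \<open>Enlarging the radius makes it positive whatever \<open>R\<close> is, and
    \<open>e \<le> R'\<close> keeps the half-radius balls around net points inside
    \<open>ball x0 (2 * R')\<close>.\<close>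
  define R' where "R' = max R e"
  have R': "0 < R'" "R \<le> R'" "e \<le> R'" using assms by (auto simp: R'_def)
  obtain n where n: "2 * R' / (e / 2) < 2 ^ n" using real_arch_pow[of 2] by auto
  \<comment> \<open>Since \<open>2 ^ n * (e / 2)\<close> exceeds \<open>2 * R'\<close>, doubling
    \<open>ball x (e / 2)\<close> n times swallows \<open>ball x0 R'\<close> for every centre in the
    closed ball; \<open>v\<close> is the resulting lower bound for the mass of the small
    balls.\<close>
  define v where "v = V x0 R' / C ^ n"
  have v: "0 < v" using V_pos R' C_gt_1 by (simp add: v_def)
  have v_le: "v \<le> V x (e / 2)" if x: "x \<in> cball x0 R" for x
  proof -
    have "ball x0 R' \<subseteq> ball x (2 ^ n * (e / 2))"
    proof
      fix z assume "z \<in> ball x0 R'"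
      then have "dist x z < 2 * R'" using dist_triangle[of x z x0] x R' by (simp add: dist_commute)
      also have "\<dots> < 2 ^ n * (e / 2)" using n assms by (simp add: divide_simps)
      finally show "z \<in> ball x (2 ^ n * (e / 2))" by simp
    qed
    then have "V x0 R' \<le> V x (2 ^ n * (e / 2))" by (rule V_mono)
    also have "\<dots> \<le> C ^ n * V x (e / 2)" using assms by (intro V_iterate) simp
    finally show ?thesis using C_gt_1 by (simp add: v_def divide_simps mult.commute)
  qed
  define sep where "sep k \<longleftrightarrow> finite k \<and> k \<subseteq> cball x0 R \<and> (\<forall>x\<in>k. \<forall>y\<in>k. x \<noteq> y \<longrightarrow> e \<le> dist x y)" for k
  have bound: "real (card k) * v \<le> V x0 (2 * R')" if k: "sep k" for k
  proof -
    have fin: "finite k" using k by (simp add: sep_def)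
    have disj: "disjoint_family_on (\<lambda>x. ball x (e / 2)) k"
    proof (unfold disjoint_family_on_def, intro ballI impI)
      fix x y assume xy: "x \<in> k" "y \<in> k" "x \<noteq> y"
      then have "e \<le> dist x y" using k by (auto simp: sep_def)
      then show "ball x (e / 2) \<inter> ball y (e / 2) = {}"
        by (auto simp: disjoint_iff) (smt (verit, best) dist_commute dist_triangle field_sum_of_halves)
    qed
    have "real (card k) * v = (\<Sum>x\<in>k. v)" by simp
    also have "\<dots> \<le> (\<Sum>x\<in>k. V x (e / 2))"
      using k by (intro sum_mono v_le) (auto simp: sep_def)
    also have "\<dots> = measure \<nu> (\<Union>x\<in>k. ball x (e / 2))"
      using fin disj by (intro measure_finite_Union[symmetric]) (auto simp: emeasure_ball)
    also have "\<dots> \<le> V x0 (2 * R')"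
    proof (rule measure_mono_fmeasurable)
      show "(\<Union>x\<in>k. ball x (e / 2)) \<subseteq> ball x0 (2 * R')"
      proof
        fix z assume "z \<in> (\<Union>x\<in>k. ball x (e / 2))"
        then obtain x where x: "x \<in> k" "dist x z < e / 2" by auto
        then have "dist x0 x \<le> R" using k by (auto simp: sep_def)
        then show "z \<in> ball x0 (2 * R')" using x dist_triangle[of x0 z x] R' by auto
      qed
      show "ball x0 (2 * R') \<in> fmeasurable \<nu>" by (intro fmeasurableI) (auto simp: emeasure_ball)
    qed (use fin in \<open>auto intro!: sets.finite_UN\<close>)
    finally show ?thesis .
  qed
  have card_le: "card k \<le> nat \<lceil>V x0 (2 * R') / v\<rceil>" if "sep k" for k
  proof -
    have "real (card k) \<le> V x0 (2 * R') / v" using bound[OF that] v by (simp add: divide_simps)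
    then show ?thesis by linarith
  qed
  have "\<exists>k. sep k \<and> (\<forall>k'. sep k' \<longrightarrow> card k' \<le> card k)"
  proof (rule ex_has_greatest_nat)
    show "sep {}" by (simp add: sep_def)
    show "\<forall>k. sep k \<longrightarrow> card k < Suc (nat \<lceil>V x0 (2 * R') / v\<rceil>)"
      using card_le by (simp add: less_Suc_eq_le)
  qed
  then obtain k where k: "sep k" and max: "\<And>k'. sep k' \<Longrightarrow> card k' \<le> card k" by blast
  have "cball x0 R \<subseteq> (\<Union>x\<in>k. ball x e)"
  proof
    fix z assume z: "z \<in> cball x0 R"
    show "z \<in> (\<Union>x\<in>k. ball x e)"
    proof (rule ccontr)
      assume nz: "z \<notin> (\<Union>x\<in>k. ball x e)"
      then have "z \<notin> k" using assms by auto
      moreover have "sep (insert z k)"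
        using k z nz by (auto simp: sep_def dist_commute not_less)
      ultimately show False using max[of "insert z k"] k by (auto simp: sep_def)
    qed
  qed
  then show ?thesis using k by (auto simp: sep_def)
qed

text \<open>Take the union over \<open>n\<close> of finite nets of mesh
  \<open>1 / real (Suc n)\<close> in the closed balls of radius \<open>n\<close>.\<close>

lemma ex_countable_dense: "\<exists>D::'a set. countable D \<and> (\<forall>x. \<forall>e>0. \<exists>q\<in>D. dist x q < e)"
proof -
  define x0 :: 'a where "x0 = undefined"
  have "\<forall>n. \<exists>k. finite k \<and> cball x0 (real n) \<subseteq> (\<Union>x\<in>k. ball x (1 / real (Suc n)))"
    by (intro allI finite_net) simp
  then obtain k where fin: "\<And>n. finite (k n)"
    and cov: "\<And>n. cball x0 (real n) \<subseteq> (\<Union>x\<in>k n. ball x (1 / real (Suc n)))"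
    by metis
  show ?thesis
  proof (intro exI[of _ "\<Union>n. k n"] conjI allI impI)
    show "countable (\<Union>n. k n)" using fin by (auto intro: countable_finite)
    fix x :: 'a and e :: real assume e: "0 < e"
    obtain n where n: "max (dist x0 x) (1 / e) < real n" using reals_Archimedean2 by blast
    then have "x \<in> cball x0 (real n)" by simp
    then obtain q where q: "q \<in> k n" "dist q x < 1 / real (Suc n)" using cov by (auto simp: subset_iff)
    have "1 / real (Suc n) < e"
      using n e by (auto simp: divide_simps algebra_simps)
    then show "\<exists>q\<in>\<Union>n. k n. dist x q < e" using q by (auto simp: dist_commute intro!: bexI[of _ q])
  qed
qed

text \<open>The product \<open>\<sigma>\<close>-algebra contains the Borel sets of \<open>Y \<times> Y\<close> only because \<open>Y\<close> is separable,
  which doubling provides.\<close>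

lemma dist_pair_measurable [measurable]:
  "(\<lambda>z. dist (fst z) (snd z)) \<in> borel_measurable (\<nu> \<Otimes>\<^sub>M \<nu>)"
proof -
  obtain D :: "'a set" where D: "countable D" "\<And>x e. 0 < e \<Longrightarrow> \<exists>q\<in>D. dist x q < e"
    using ex_countable_dense by blast
  show ?thesis
  proof (rule borel_measurable_iff_less[THEN iffD2], rule allI)
    fix a :: real
    \<comment> \<open>Through the dense set, the sublevel set becomes a countable union of sets cut
      out by sums of functions of the separate coordinates.\<close>
    have "dist x y < a \<longleftrightarrow> (\<exists>q\<in>D. dist q x + dist q y < a)" for x y
    proof
      assume "dist x y < a"
      then obtain q where "q \<in> D" "dist x q < (a - dist x y) / 2" using D(2) by (meson diff_gt_0_iff_gt half_gt_zero)
      then show "\<exists>q\<in>D. dist q x + dist q y < a"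
        using dist_triangle[of q y x] by (intro bexI[of _ q]) (auto simp: dist_commute field_simps)
    next
      assume "\<exists>q\<in>D. dist q x + dist q y < a"
      then show "dist x y < a" by (metis dist_commute dist_triangle le_less_trans)
    qed
    then have "{w \<in> space (\<nu> \<Otimes>\<^sub>M \<nu>). dist (fst w) (snd w) < a} =
      (\<Union>q\<in>D. {w \<in> space (\<nu> \<Otimes>\<^sub>M \<nu>). dist q (fst w) + dist q (snd w) < a})" by auto
    also have "\<dots> \<in> sets (\<nu> \<Otimes>\<^sub>M \<nu>)"
      using D(1) by (intro sets.countable_UN'') auto
    finally show "{w \<in> space (\<nu> \<Otimes>\<^sub>M \<nu>). dist (fst w) (snd w) < a} \<in> sets (\<nu> \<Otimes>\<^sub>M \<nu>)" .
  qed
qed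

text \<open>The volume is the integral, over a third variable \<open>w\<close>, of a jointly
  measurable indicator; sigma-finiteness then makes it measurable in the other two.\<close>

lemma V_pair_measurable [measurable]:
  "(\<lambda>z. V (fst z) (dist (fst z) (snd z))) \<in> borel_measurable (\<nu> \<Otimes>\<^sub>M \<nu>)"
proof -
  interpret sigma_finite_measure \<nu> by (rule sigma_finite)
  have "(\<lambda>w. (fst (fst w), snd w)) \<in> (\<nu> \<Otimes>\<^sub>M \<nu>) \<Otimes>\<^sub>M \<nu> \<rightarrow>\<^sub>M \<nu> \<Otimes>\<^sub>M \<nu>" by simp
  from measurable_compose[OF this dist_pair_measurable]
  have [measurable]: "(\<lambda>w. dist (fst (fst w)) (snd w)) \<in> borel_measurable ((\<nu> \<Otimes>\<^sub>M \<nu>) \<Otimes>\<^sub>M \<nu>)" by simp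
  have "(\<lambda>z. \<integral>\<^sup>+w. indicator {w. dist (fst z) w < dist (fst z) (snd z)} w \<partial>\<nu>) \<in> borel_measurable (\<nu> \<Otimes>\<^sub>M \<nu>)"
    by measurable
  moreover have "(\<integral>\<^sup>+w. indicator {w. dist (fst z) w < dist (fst z) (snd z)} w \<partial>\<nu>)
     = emeasure \<nu> (ball (fst z) (dist (fst z) (snd z)))" for z :: "'a \<times> 'a"
    by (simp add: ball_def[symmetric])
  ultimately show ?thesis by (simp add: measure_def)
qed

subsection \<open>Kernel integrals over dyadic annuli\<close>

text \<open>On each annulus doubling bounds the mass of the outer ball by that of the inner one,
  which cancels the denominator; a geometric series remains.\<close>

lemma nn_integral_annuli:
  assumes \<rho>: "\<And>i::nat. 0 < \<rho> i" and b: "0 \<le> b" and q: "0 \<le> q" "q < 1"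
    and cover: "\<And>y. f y \<noteq> 0 \<Longrightarrow> \<exists>i. \<rho> i \<le> dist x y \<and> dist x y < 2 * \<rho> i
      \<and> f y \<le> ennreal (b * q ^ i / V x (\<rho> i))"
  shows "(\<integral>\<^sup>+y. f y \<partial>\<nu>) \<le> ennreal (C * b / (1 - q))"
proof -
  define A where "A i = ball x (2 * \<rho> i)" for i
  define g where "g i y = ennreal (b * q ^ i / V x (\<rho> i)) * indicator (A i) y" for i y
  have [measurable]: "A i \<in> sets \<nu>" for i by (simp add: A_def)
  have [measurable]: "g i \<in> borel_measurable \<nu>" for i unfolding g_def by simp
  have "f y \<le> (\<Sum>i. g i y)" for y
  proof (cases "f y = 0")
    case False
    then obtain i where "\<rho> i \<le> dist x y" "dist x y < 2 * \<rho> i"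
      "f y \<le> ennreal (b * q ^ i / V x (\<rho> i))" using cover by blast
    then have "f y \<le> g i y" by (simp add: g_def A_def)
    also have "\<dots> \<le> (\<Sum>i. g i y)"
      using sum_le_suminf[of "\<lambda>i. g i y" "{i}"] by (simp add: summableI)
    finally show ?thesis .
  qed simp
  then have "(\<integral>\<^sup>+y. f y \<partial>\<nu>) \<le> (\<integral>\<^sup>+y. (\<Sum>i. g i y) \<partial>\<nu>)" by (intro nn_integral_mono)
  also have "\<dots> = (\<Sum>i. \<integral>\<^sup>+y. g i y \<partial>\<nu>)" by (intro nn_integral_suminf) simp
  also have "\<dots> \<le> (\<Sum>i. ennreal (C * b * q ^ i))"
  proof (intro suminf_le summableI)
    fix i
    have "(\<integral>\<^sup>+y. g i y \<partial>\<nu>) = ennreal (b * q ^ i / V x (\<rho> i)) * ennreal (V x (2 * \<rho> i))"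
      unfolding g_def by (subst nn_integral_cmult_indicator) (auto simp: A_def emeasure_ball)
    also have "\<dots> = ennreal (b * q ^ i / V x (\<rho> i) * V x (2 * \<rho> i))"
      using b q by (intro ennreal_mult[symmetric]) auto
    also have "\<dots> \<le> ennreal (b * q ^ i / V x (\<rho> i) * (C * V x (\<rho> i)))"
      using b q \<rho> by (intro ennreal_leI mult_left_mono doubling) auto
    also have "b * q ^ i / V x (\<rho> i) * (C * V x (\<rho> i)) = C * b * q ^ i"
      using V_pos[OF \<rho>, of x i] by simp
    finally show "(\<integral>\<^sup>+y. g i y \<partial>\<nu>) \<le> ennreal (C * b * q ^ i)" .
  qed
  also have "\<dots> = ennreal (C * b * (1 / (1 - q)))"
    using b q C_gt_1 by (intro suminf_ennreal_eq sums_mult geometric_sums) auto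
  finally show ?thesis by simp
qed

text \<open>Annuli growing from radius \<open>m\<close>. Both the power and the volume are estimated
  at the inner radius, and each doubling gains \<open>2 powr (- s)\<close>.\<close>

lemma nn_integral_kernel_far:
  assumes s: "0 < s" and m: "0 < m"
  shows "(\<integral>\<^sup>+y. (if m \<le> dist x y then ennreal (dist x y powr (- s) / V x (dist x y)) else 0) \<partial>\<nu>)
    \<le> ennreal (C * m powr (- s) / (1 - 2 powr (- s)))"
proof (rule nn_integral_annuli[where \<rho> = "\<lambda>i. m * 2 ^ i"])
  show "2 powr (- s) < 1" using s by (simp add: powr_minus_divide)
  fix y
  assume "(if m \<le> dist x y then ennreal (dist x y powr (- s) / V x (dist x y)) else 0) \<noteq> 0"
  then have my: "m \<le> dist x y" by (auto split: if_splits)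
  then obtain i where i: "2 ^ i \<le> dist x y / m" "dist x y / m < 2 ^ Suc i"
    using ex_dyadic_ge_one[of "dist x y / m"] m by auto
  have le: "m * 2 ^ i \<le> dist x y" "dist x y < 2 * (m * 2 ^ i)"
    using i m by (simp_all add: divide_simps mult_ac)
  have "dist x y powr (- s) \<le> (m * 2 ^ i) powr (- s)"
    using le m s by (intro powr_mono2') auto
  also have "\<dots> = m powr (- s) * (2 powr (- s)) ^ i"
    using m by (simp add: powr_mult powr_power powr_realpow[symmetric] powr_powr mult.commute)
  finally have *: "dist x y powr (- s) \<le> m powr (- s) * (2 powr (- s)) ^ i" .
  have "V x (m * 2 ^ i) \<le> V x (dist x y)" using le by (intro V_mono) auto
  then have "dist x y powr (- s) / V x (dist x y) \<le> m powr (- s) * (2 powr (- s)) ^ i / V x (m * 2 ^ i)"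
    using * m by (intro frac_le V_pos) auto
  then show "\<exists>i. m * 2 ^ i \<le> dist x y \<and> dist x y < 2 * (m * 2 ^ i) \<and>
     (if m \<le> dist x y then ennreal (dist x y powr (- s) / V x (dist x y)) else 0)
       \<le> ennreal (m powr (- s) * (2 powr (- s)) ^ i / V x (m * 2 ^ i))"
    using le my by (intro exI[of _ i]) (auto intro!: ennreal_leI)
qed (use m in auto)

text \<open>Annuli shrinking from radius \<open>m\<close>. The power now increases with distance, so
  it is estimated at the outer radius, while the volume is still estimated at the inner one.\<close>

lemma nn_integral_kernel_near:
  assumes s: "0 < s" and m: "0 < m"
  shows "(\<integral>\<^sup>+y. (if x \<noteq> y \<and> dist x y < m then ennreal (dist x y powr s / V x (dist x y)) else 0) \<partial>\<nu>)
    \<le> ennreal (C * m powr s / (1 - 2 powr (- s)))"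
proof (rule nn_integral_annuli[where \<rho> = "\<lambda>i. m / 2 ^ Suc i"])
  show "2 powr (- s) < 1" using s by (simp add: powr_minus_divide)
  fix y
  assume "(if x \<noteq> y \<and> dist x y < m then ennreal (dist x y powr s / V x (dist x y)) else 0) \<noteq> 0"
  then have my: "0 < dist x y" "dist x y < m" by (auto split: if_splits)
  then obtain i where i: "2 ^ i < m / dist x y" "m / dist x y \<le> 2 ^ Suc i"
    using ex_dyadic_gt_one[of "m / dist x y"] m by auto
  have le: "m / 2 ^ Suc i \<le> dist x y" "dist x y < 2 * (m / 2 ^ Suc i)"
    using i m my by (simp_all add: divide_simps mult_ac)
  have "dist x y powr s \<le> (m / 2 ^ i) powr s"
    using le m s by (intro powr_mono2) auto
  also have "\<dots> = m powr s * (2 powr (- s)) ^ i"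
    using m by (simp add: powr_divide powr_power powr_realpow[symmetric] powr_powr mult.commute powr_minus_divide)
  finally have *: "dist x y powr s \<le> m powr s * (2 powr (- s)) ^ i" .
  have "V x (m / 2 ^ Suc i) \<le> V x (dist x y)" using le by (intro V_mono) auto
  then have "dist x y powr s / V x (dist x y) \<le> m powr s * (2 powr (- s)) ^ i / V x (m / 2 ^ Suc i)"
    using * m by (intro frac_le V_pos) auto
  then show "\<exists>i. m / 2 ^ Suc i \<le> dist x y \<and> dist x y < 2 * (m / 2 ^ Suc i) \<and>
     (if x \<noteq> y \<and> dist x y < m then ennreal (dist x y powr s / V x (dist x y)) else 0)
       \<le> ennreal (m powr s * (2 powr (- s)) ^ i / V x (m / 2 ^ Suc i))"
    using le my by (intro exI[of _ i]) (auto intro!: ennreal_leI)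
qed (use m in auto)

lemma V_dist_measurable [measurable]: "(\<lambda>y. V x (dist x y)) \<in> borel_measurable \<nu>"
proof -
  have "(\<lambda>y. (x, y)) \<in> \<nu> \<rightarrow>\<^sub>M \<nu> \<Otimes>\<^sub>M \<nu>" by simp
  from measurable_compose[OF this V_pair_measurable] show ?thesis by simp
qed

lemma ln_powr_le:
  fixes a t p :: real
  assumes "0 < a" "1 \<le> t" "0 < p"
  shows "ln (1 + t) powr p \<le> (2 powr a / a) powr p * t powr (a * p)"
proof -
  have "ln (1 + t) \<le> (1 + t) powr a / a"
    using assms ln_powr_bound[of "1 + t" a] by simp
  also have "\<dots> \<le> (2 * t) powr a / a"
    using assms by (intro divide_right_mono powr_mono2) auto
  also have "\<dots> = 2 powr a / a * t powr a" using assms by (simp add: powr_mult)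
  finally have "ln (1 + t) powr p \<le> (2 powr a / a * t powr a) powr p"
    using assms by (intro powr_mono2) auto
  also have "\<dots> = (2 powr a / a) powr p * t powr (a * p)"
    using assms by (subst powr_mult) (auto simp: powr_powr)
  finally show ?thesis .
qed

text \<open>Split at \<open>dist x y = m\<close>. Near \<open>x\<close>,
  \<open>ln (1 + t) \<le> t\<close> leaves the positive exponent \<open>p - \<theta> * p\<close> of
  the distance; far away the logarithm is absorbed by a power smaller than \<open>\<theta>\<close>,
  and decay survives. Both pieces scale like \<open>m powr (- (\<theta> * p))\<close>, with a
  constant uniform in \<open>x\<close> and \<open>m\<close>.\<close>

lemma nn_integral_log_kernel:
  assumes p: "1 \<le> p" and \<theta>: "0 < \<theta>" "\<theta> < 1"
  obtains K where "0 < K" "\<And>x m. 0 < m \<Longrightarrow>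
    (\<integral>\<^sup>+y. (if x = y then 0 else ennreal (ln (1 + dist x y / m) powr p * dist x y powr (- (\<theta> * p)) / V x (dist x y))) \<partial>\<nu>)
    \<le> ennreal (K * m powr (- (\<theta> * p)))"
proof
  \<comment> \<open>Any exponent strictly between 0 and \<open>\<theta>\<close> serves: it keeps the
    far decay exponent \<open>t\<close> positive.\<close>
  define a where "a = \<theta> / 2"
  define s where "s = p - \<theta> * p"
  define t where "t = \<theta> * p - a * p"
  define k where "k = (2 powr a / a) powr p"
  define K where "K = C / (1 - 2 powr (- s)) + k * (C / (1 - 2 powr (- t)))"
  have a: "0 < a" "a < \<theta>" using \<theta> by (auto simp: a_def)
  have s: "0 < s" using p \<theta> by (simp add: s_def)
  have t: "0 < t" using p a by (simp add: t_def)
  have lt: "2 powr (- s) < 1" "2 powr (- t) < 1" using s t by (simp_all add: powr_minus_divide)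
  have k: "0 < k" using a by (simp add: k_def)
  show "0 < K" unfolding K_def using C_gt_1 lt k by (intro add_pos_pos mult_pos_pos divide_pos_pos) auto
  fix x :: 'a and m :: real assume m: "0 < m"
  define f1 where "f1 y = (if x \<noteq> y \<and> dist x y < m then ennreal (dist x y powr s / V x (dist x y)) else 0)" for y
  define f2 where "f2 y = (if m \<le> dist x y then ennreal (dist x y powr (- t) / V x (dist x y)) else 0)" for y
  have eq: "{y. x \<noteq> y \<and> dist x y < m} = ball x m - {x}" "{y. m \<le> dist x y} = UNIV - ball x m" by auto
  have [measurable]: "{y. x \<noteq> y \<and> dist x y < m} \<in> sets \<nu>" "{y. m \<le> dist x y} \<in> sets \<nu>"
    unfolding eq by (auto simp: sets_eq)
  have [measurable]: "f1 \<in> borel_measurable \<nu>" "f2 \<in> borel_measurable \<nu>"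
    unfolding f1_def f2_def by (auto intro!: measurable_If)
  have "(\<integral>\<^sup>+y. (if x = y then 0 else ennreal (ln (1 + dist x y / m) powr p * dist x y powr (- (\<theta> * p)) / V x (dist x y))) \<partial>\<nu>)
     \<le> (\<integral>\<^sup>+y. ennreal (m powr (- p)) * f1 y + ennreal (k * m powr (- (a * p))) * f2 y \<partial>\<nu>)"
  proof (rule nn_integral_mono)
    fix y
    let ?d = "dist x y"
    show "(if x = y then 0 else ennreal (ln (1 + ?d / m) powr p * ?d powr (- (\<theta> * p)) / V x ?d))
      \<le> ennreal (m powr (- p)) * f1 y + ennreal (k * m powr (- (a * p))) * f2 y"
    proof (cases "x = y")
      case False
      then have d: "0 < ?d" by simp
      show ?thesis
      proof (cases "?d < m")
        case True
        have "ln (1 + ?d / m) powr p \<le> (?d / m) powr p"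
          using m d p by (intro powr_mono2 ln_add_one_self_le_self) auto
        then have "ln (1 + ?d / m) powr p * ?d powr (- (\<theta> * p)) / V x ?d
          \<le> (?d / m) powr p * ?d powr (- (\<theta> * p)) / V x ?d"
          by (intro divide_right_mono mult_right_mono) auto
        also have "\<dots> = m powr (- p) * (?d powr s / V x ?d)"
          using d m by (simp add: s_def powr_divide powr_diff powr_minus_divide)
        finally show ?thesis using True False
          by (simp add: f1_def f2_def ennreal_mult'[symmetric] ennreal_leI)
      next
        case far: False
        have "ln (1 + ?d / m) powr p \<le> k * (?d / m) powr (a * p)"
          unfolding k_def using m far p a by (intro ln_powr_le) auto
        then have "ln (1 + ?d / m) powr p * ?d powr (- (\<theta> * p)) / V x ?d
          \<le> k * (?d / m) powr (a * p) * ?d powr (- (\<theta> * p)) / V x ?d"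
          by (intro divide_right_mono mult_right_mono) auto
        also have "\<dots> = k * m powr (- (a * p)) * (?d powr (- t) / V x ?d)"
          using d m by (simp add: t_def powr_divide powr_diff powr_minus_divide)
        finally show ?thesis using far False k
          by (simp add: f1_def f2_def ennreal_mult'[symmetric] ennreal_leI)
      qed
    qed simp
  qed
  also have "\<dots> = ennreal (m powr (- p)) * (\<integral>\<^sup>+y. f1 y \<partial>\<nu>) + ennreal (k * m powr (- (a * p))) * (\<integral>\<^sup>+y. f2 y \<partial>\<nu>)"
    by (simp add: nn_integral_add nn_integral_cmult)
  also have "\<dots> \<le> ennreal (m powr (- p)) * ennreal (C * m powr s / (1 - 2 powr (- s)))
      + ennreal (k * m powr (- (a * p))) * ennreal (C * m powr (- t) / (1 - 2 powr (- t)))"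
    unfolding f1_def f2_def
    by (intro add_mono mult_left_mono nn_integral_kernel_near nn_integral_kernel_far s t m) auto
  also have "\<dots> = ennreal (m powr (- p) * (C * m powr s / (1 - 2 powr (- s)))
      + k * m powr (- (a * p)) * (C * m powr (- t) / (1 - 2 powr (- t))))"
    using k lt C_gt_1 by (simp add: ennreal_mult'[symmetric] ennreal_plus[symmetric] del: ennreal_plus)
  also have "m powr (- p) * (C * m powr s / (1 - 2 powr (- s)))
      + k * m powr (- (a * p)) * (C * m powr (- t) / (1 - 2 powr (- t))) = K * m powr (- (\<theta> * p))"
  proof -
    have "m powr (- p) * m powr s = m powr (- (\<theta> * p))" "m powr (- (a * p)) * m powr (- t) = m powr (- (\<theta> * p))"
      using m by (simp_all add: powr_add[symmetric] s_def t_def)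
    then show ?thesis unfolding K_def by (simp add: distrib_right) (simp add: algebra_simps)
  qed
  finally show "(\<integral>\<^sup>+y. (if x = y then 0 else ennreal (ln (1 + dist x y / m) powr p * dist x y powr (- (\<theta> * p)) / V x (dist x y))) \<partial>\<nu>)
    \<le> ennreal (K * m powr (- (\<theta> * p)))" .
qed

end

subsection \<open>Energy of the logarithmic cutoff\<close>

text \<open>The seminorm enters both capacities only through its p-th power.\<close>

definition besov_energy :: "'a::metric_space measure \<Rightarrow> real \<Rightarrow> real \<Rightarrow> ('a \<Rightarrow> real) \<Rightarrow> ennreal" where
  "besov_energy \<nu> \<theta> p u =
     (\<integral>\<^sup>+x. (\<integral>\<^sup>+y.
          (if x = y then 0
           else ennreal (\<bar>u x - u y\<bar> powr p / dist x y powr (\<theta> * p)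
                         / measure \<nu> (ball x (dist x y)))) \<partial>\<nu>) \<partial>\<nu>)"

lemma besov_seminorm_powr:
  "0 < p \<Longrightarrow> ennreal_powr (besov_seminorm \<nu> \<theta> p u) p = besov_energy \<nu> \<theta> p u"
  by (simp add: besov_seminorm_def besov_energy_def ennreal_powr_powr_inverse)

lemma Lp_norm_powr:
  "0 < p \<Longrightarrow> ennreal_powr (Lp_norm \<nu> p u) p = (\<integral>\<^sup>+x. ennreal (\<bar>u x\<bar> powr p) \<partial>\<nu>)"
  by (simp add: Lp_norm_def ennreal_powr_powr_inverse)

text \<open>Clamping the distance to the interval from \<open>\<rho>\<close> to \<open>r\<close>
  lets one formula cover the inner ball (value 1), the exterior (value 0) and the logarithmic
  profile in between.\<close>

definition log_cutoff :: "'a::metric_space \<Rightarrow> real \<Rightarrow> real \<Rightarrow> 'a \<Rightarrow> real" where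
  "log_cutoff x0 r \<rho> x = ln (r / max \<rho> (min r (dist x0 x))) / ln (r / \<rho>)"

lemma log_cutoff_bounds:
  assumes "0 < \<rho>" "\<rho> < r"
  shows "0 \<le> log_cutoff x0 r \<rho> x" "log_cutoff x0 r \<rho> x \<le> 1"
proof -
  have m: "\<rho> \<le> max \<rho> (min r (dist x0 x))" "max \<rho> (min r (dist x0 x)) \<le> r" using assms by auto
  then have "ln (r / max \<rho> (min r (dist x0 x))) \<le> ln (r / \<rho>)"
    using assms by (subst ln_le_cancel_iff) (auto intro!: divide_left_mono simp del: max.bounded_iff)
  moreover have "0 \<le> ln (r / max \<rho> (min r (dist x0 x)))"
    using m assms by (intro ln_ge_zero) (simp add: le_divide_eq)
  moreover have "0 < ln (r / \<rho>)" using assms by simp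
  ultimately show "0 \<le> log_cutoff x0 r \<rho> x" "log_cutoff x0 r \<rho> x \<le> 1"
    unfolding log_cutoff_def by (simp_all add: divide_le_eq)
qed

lemma log_cutoff_eq_1: "0 < \<rho> \<Longrightarrow> \<rho> < r \<Longrightarrow> dist x0 x \<le> \<rho> \<Longrightarrow> log_cutoff x0 r \<rho> x = 1"
  by (simp add: log_cutoff_def)

lemma log_cutoff_eq_0: "0 < \<rho> \<Longrightarrow> \<rho> < r \<Longrightarrow> r \<le> dist x0 x \<Longrightarrow> log_cutoff x0 r \<rho> x = 0"
  by (simp add: log_cutoff_def)

text \<open>With clamped distances \<open>a \<le> b\<close> the difference is
  \<open>ln (b / a) / ln (r / \<rho>)\<close>, and the triangle inequality gives
  \<open>b \<le> a + dist x y\<close>. If the nearer point is outside the ball, both values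
  vanish.\<close>

lemma log_cutoff_diff_le:
  assumes \<rho>: "0 < \<rho>" "\<rho> < r" and le: "dist x0 x \<le> dist x0 y"
  shows "\<bar>log_cutoff x0 r \<rho> x - log_cutoff x0 r \<rho> y\<bar>
    \<le> (if x \<in> ball x0 r then ln (1 + dist x y / max \<rho> (dist x0 x)) / ln (r / \<rho>) else 0)"
proof (cases "dist x0 x < r")
  case True
  define a where "a = max \<rho> (dist x0 x)"
  define b where "b = max \<rho> (min r (dist x0 y))"
  have a: "0 < a" "max \<rho> (min r (dist x0 x)) = a" using True \<rho> by (auto simp: a_def)
  have ab: "a \<le> b" using le True \<rho> by (auto simp: a_def b_def)
  have "b \<le> a + dist x y"
    using dist_triangle[of x0 y x] zero_le_dist[of x y] unfolding a_def b_def by linarith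
  then have "b / a \<le> 1 + dist x y / a" using a by (simp add: divide_simps)
  have "\<bar>log_cutoff x0 r \<rho> x - log_cutoff x0 r \<rho> y\<bar> = ln (b / a) / ln (r / \<rho>)"
  proof -
    have "0 \<le> ln (b / a)" using a ab by simp
    moreover have "0 < ln (r / \<rho>)" using \<rho> by simp
    moreover have "log_cutoff x0 r \<rho> x - log_cutoff x0 r \<rho> y = ln (b / a) / ln (r / \<rho>)"
      using a ab \<rho> unfolding log_cutoff_def a(2) b_def[symmetric]
      by (simp add: ln_div diff_divide_distrib[symmetric])
    ultimately show ?thesis by simp
  qed
  also have "\<dots> \<le> ln (1 + dist x y / a) / ln (r / \<rho>)"
    using \<open>b / a \<le> _\<close> a ab \<rho> by (intro divide_right_mono ln_mono) auto
  finally show ?thesis using True by (simp add: a_def)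
next
  case False
  then show ?thesis using le \<rho> by (simp add: log_cutoff_eq_0)
qed

context doubling_space
begin

lemma log_cutoff_measurable [measurable]: "log_cutoff x0 r \<rho> \<in> borel_measurable \<nu>"
  unfolding log_cutoff_def[abs_def] by measurable

text \<open>The pointwise bound is centred at the point nearer to \<open>x0\<close>. Pairs in the
  other order are reflected at the cost of the factor \<open>C\<close>, after which the kernel
  integral is taken in the farther variable with \<open>m x\<close> as its scale.\<close>

lemma besov_energy_log_cutoff:
  assumes p: "1 \<le> p" and \<theta>: "0 < \<theta>" "\<theta> < 1"
  obtains K where "0 < K" "\<And>x0 r \<rho>. 0 < \<rho> \<Longrightarrow> \<rho> < r \<Longrightarrow>
    besov_energy \<nu> \<theta> p (log_cutoff x0 r \<rho>) \<le> ennreal (K / ln (r / \<rho>) powr p)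
      * (\<integral>\<^sup>+x. ennreal (max \<rho> (dist x0 x) powr (- (\<theta> * p))) * indicator (ball x0 r) x \<partial>\<nu>)"
proof -
  obtain K where K: "0 < K" and kernel: "\<And>x m. 0 < m \<Longrightarrow>
    (\<integral>\<^sup>+y. (if x = y then 0 else ennreal (ln (1 + dist x y / m) powr p * dist x y powr (- (\<theta> * p)) / V x (dist x y))) \<partial>\<nu>)
    \<le> ennreal (K * m powr (- (\<theta> * p)))"
    using nn_integral_log_kernel[OF p \<theta>] by blast
  show ?thesis
  proof (rule that[of "(1 + C) * K"])
    show "0 < (1 + C) * K" using K C_gt_1 by simp
    fix x0 :: 'a and r \<rho> :: real assume \<rho>: "0 < \<rho>" "\<rho> < r"
    define u where "u = log_cutoff x0 r \<rho>"
    define L where "L = ln (r / \<rho>)"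
    have L: "0 < L" using \<rho> by (simp add: L_def)
    define m where "m x = max \<rho> (dist x0 x)" for x
    have m: "0 < m x" for x using \<rho> by (auto simp: m_def)
    define h where "h x y = ln (1 + dist x y / m x) powr p * dist x y powr (- (\<theta> * p)) / V x (dist x y)" for x y
    \<comment> \<open>One-sided majorant: up to the factor \<open>1 / L powr p\<close> it controls a
      pair whose first point is the nearer one; the indicator records that such pairs contribute
      nothing outside the ball.\<close>
    define H where "H x y = (if x = y then 0 else ennreal (h x y)) * indicator (ball x0 r) x" for x y
    have h_nonneg: "0 \<le> h x y" for x y by (simp add: h_def)
    have H_pair [measurable]: "(\<lambda>z. H (fst z) (snd z)) \<in> borel_measurable (\<nu> \<Otimes>\<^sub>M \<nu>)"
    proof -
      \<comment> \<open>The diagonal is expressed as the zero set of the distance, whose joint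
        measurability is known.\<close>
      have "(\<lambda>z. H (fst z) (snd z)) = (\<lambda>z. (if dist (fst z) (snd z) = 0 then 0
        else ennreal (h (fst z) (snd z))) * indicator (ball x0 r) (fst z))"
        by (simp add: H_def fun_eq_iff)
      then show ?thesis unfolding h_def m_def by (simp only:) measurable
    qed
    have H_swap [measurable]: "(\<lambda>z. H (snd z) (fst z)) \<in> borel_measurable (\<nu> \<Otimes>\<^sub>M \<nu>)"
      using measurable_compose[OF measurable_pair_swap' H_pair] by (simp add: case_prod_beta)
    have H1 [measurable]: "(\<lambda>y. H x y) \<in> borel_measurable \<nu>" for x
      using measurable_compose[OF _ H_pair, of "\<lambda>y. (x, y)"] by simp
    have H2 [measurable]: "(\<lambda>y. H y x) \<in> borel_measurable \<nu>" for x
      using measurable_compose[OF _ H_swap, of "\<lambda>y. (x, y)"] by simp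
    define e where "e x y = (if x = y then 0
           else ennreal (\<bar>u x - u y\<bar> powr p / dist x y powr (\<theta> * p) / V x (dist x y)))" for x y
    have near: "e x y \<le> ennreal (1 / L powr p) * H x y"
      if le: "dist x0 x \<le> dist x0 y" for x y
    proof (cases "x \<noteq> y \<and> x \<in> ball x0 r")
      case True
      then have "\<bar>u x - u y\<bar> \<le> ln (1 + dist x y / m x) / L"
        using log_cutoff_diff_le[OF \<rho> le] by (simp add: u_def m_def L_def)
      then have "\<bar>u x - u y\<bar> powr p \<le> (ln (1 + dist x y / m x) / L) powr p"
        using p by (intro powr_mono2) auto
      also have "\<dots> = 1 / L powr p * ln (1 + dist x y / m x) powr p"
        using L m[of x] by (simp add: powr_divide)
      finally have "\<bar>u x - u y\<bar> powr p / dist x y powr (\<theta> * p) / V x (dist x y)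
        \<le> 1 / L powr p * ln (1 + dist x y / m x) powr p / dist x y powr (\<theta> * p) / V x (dist x y)"
        by (intro divide_right_mono) auto
      also have "\<dots> = 1 / L powr p * h x y" by (simp add: h_def powr_minus_divide)
      finally show ?thesis using True L h_nonneg[of x y]
        by (simp add: e_def H_def ennreal_mult[symmetric] ennreal_leI)
    next
      case False
      then have "e x y = 0"
        using log_cutoff_diff_le[OF \<rho> le] p by (auto simp: e_def u_def)
      then show ?thesis by simp
    qed
    \<comment> \<open>The numerator and the distance are symmetric; only the volume depends on the
      order of the points.\<close>
    have swap: "e x y \<le> ennreal C * e y x" for x y
    proof (cases "x = y")
      case False
      have "V y (dist x y) / C \<le> V x (dist x y)"
        using V_centre_swap[OF False] C_gt_1 by (simp add: divide_simps mult.commute)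
      then have "\<bar>u x - u y\<bar> powr p / dist x y powr (\<theta> * p) / V x (dist x y)
        \<le> \<bar>u x - u y\<bar> powr p / dist x y powr (\<theta> * p) / (V y (dist x y) / C)"
        using V_pos[of "dist x y" y] C_gt_1 False
        by (intro divide_left_mono mult_pos_pos) (auto intro!: V_pos)
      also have "\<dots> = C * (\<bar>u y - u x\<bar> powr p / dist y x powr (\<theta> * p) / V y (dist y x))"
        by (simp add: dist_commute abs_minus_commute)
      finally show ?thesis using False C_gt_1
        by (simp add: e_def ennreal_mult'[symmetric] ennreal_leI)
    qed (simp add: e_def)
    \<comment> \<open>Whichever point is nearer to \<open>x0\<close>, one of the two summands
      already dominates, so no condition on the pair is left when integrating.\<close>
    have e_le: "e x y \<le> ennreal (1 / L powr p) * (H x y + ennreal C * H y x)" for x y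
    proof (cases "dist x0 x \<le> dist x0 y")
      case True
      from near[OF this] show ?thesis by (rule order_trans) (intro mult_left_mono, auto)
    next
      case False
      have "e x y \<le> ennreal C * e y x" by (rule swap)
      also have "\<dots> \<le> ennreal C * (ennreal (1 / L powr p) * H y x)"
        using False by (intro mult_left_mono near) auto
      also have "\<dots> = ennreal (1 / L powr p) * (ennreal C * H y x)" by (simp add: mult_ac)
      also have "\<dots> \<le> ennreal (1 / L powr p) * (H x y + ennreal C * H y x)"
        by (intro mult_left_mono) auto
      finally show ?thesis .
    qed
    interpret sigma_finite_measure \<nu> by (rule sigma_finite)
    interpret pair_sigma_finite \<nu> \<nu> ..
    define J where "J = (\<integral>\<^sup>+x. (\<integral>\<^sup>+y. H x y \<partial>\<nu>) \<partial>\<nu>)"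
    define W where "W = (\<integral>\<^sup>+x. ennreal (m x powr (- (\<theta> * p))) * indicator (ball x0 r) x \<partial>\<nu>)"
    have [measurable]: "(\<lambda>x. ennreal (m x powr (- (\<theta> * p))) * indicator (ball x0 r) x) \<in> borel_measurable \<nu>"
      unfolding m_def by measurable
    have J: "J \<le> ennreal K * W"
    proof -
      have "J \<le> (\<integral>\<^sup>+x. ennreal K * (ennreal (m x powr (- (\<theta> * p))) * indicator (ball x0 r) x) \<partial>\<nu>)"
        unfolding J_def
      proof (rule nn_integral_mono)
        fix x
        show "(\<integral>\<^sup>+y. H x y \<partial>\<nu>) \<le> ennreal K * (ennreal (m x powr (- (\<theta> * p))) * indicator (ball x0 r) x)"
        proof (cases "x \<in> ball x0 r")
          case True
          then show ?thesis using kernel[OF m[of x], of x] K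
            unfolding H_def h_def by (simp add: ennreal_mult)
        qed (simp add: H_def)
      qed
      also have "\<dots> = ennreal K * W" unfolding W_def by (rule nn_integral_cmult) measurable
      finally show ?thesis .
    qed
    \<comment> \<open>By Tonelli the reflected majorant has the same double integral, which produces
      the factor \<open>1 + C\<close>.\<close>
    have J_swap: "(\<integral>\<^sup>+x. (\<integral>\<^sup>+y. H y x \<partial>\<nu>) \<partial>\<nu>) = J"
      unfolding J_def using Fubini'[of "\<lambda>x y. H x y"] by (simp add: case_prod_beta)
    have "besov_energy \<nu> \<theta> p u = (\<integral>\<^sup>+x. (\<integral>\<^sup>+y. e x y \<partial>\<nu>) \<partial>\<nu>)"
      by (simp add: besov_energy_def e_def)
    also have "\<dots> \<le> (\<integral>\<^sup>+x. (\<integral>\<^sup>+y. ennreal (1 / L powr p) * (H x y + ennreal C * H y x) \<partial>\<nu>) \<partial>\<nu>)"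
      by (intro nn_integral_mono e_le)
    also have "\<dots> = (\<integral>\<^sup>+x. ennreal (1 / L powr p) * ((\<integral>\<^sup>+y. H x y \<partial>\<nu>) + ennreal C * (\<integral>\<^sup>+y. H y x \<partial>\<nu>)) \<partial>\<nu>)"
      by (simp add: nn_integral_cmult nn_integral_add)
    also have "\<dots> = ennreal (1 / L powr p) * (J + ennreal C * (\<integral>\<^sup>+x. (\<integral>\<^sup>+y. H y x \<partial>\<nu>) \<partial>\<nu>))"
    proof -
      have [measurable]: "(\<lambda>x. \<integral>\<^sup>+y. H x y \<partial>\<nu>) \<in> borel_measurable \<nu>" "(\<lambda>x. \<integral>\<^sup>+y. H y x \<partial>\<nu>) \<in> borel_measurable \<nu>"
        using H_pair H_swap by (auto intro!: borel_measurable_nn_integral simp: case_prod_beta)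
      show ?thesis unfolding J_def by (simp add: nn_integral_cmult nn_integral_add)
    qed
    also have "\<dots> = ennreal ((1 + C) / L powr p) * J"
    proof -
      have "J + ennreal C * J = ennreal (1 + C) * J" using C_gt_1 by (simp add: distrib_right)
      then show ?thesis using C_gt_1 by (simp add: J_swap mult.assoc[symmetric] ennreal_mult[symmetric] del: ennreal_plus)
    qed
    also have "\<dots> \<le> ennreal ((1 + C) / L powr p) * (ennreal K * W)"
      by (intro mult_left_mono J) auto
    also have "\<dots> = ennreal ((1 + C) * K / L powr p) * W"
      using C_gt_1 K by (simp add: mult.assoc[symmetric] ennreal_mult[symmetric])
    finally show "besov_energy \<nu> \<theta> p (log_cutoff x0 r \<rho>) \<le> ennreal ((1 + C) * K / ln (r / \<rho>) powr p)
      * (\<integral>\<^sup>+x. ennreal (max \<rho> (dist x0 x) powr (- (\<theta> * p))) * indicator (ball x0 r) x \<partial>\<nu>)"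
      by (simp add: u_def W_def m_def L_def)
  qed
qed

end

subsection \<open>Vanishing capacities\<close>

text \<open>Completeness together with the finite nets. It supplies the compact support required in
  the condenser capacity.\<close>

lemma compact_cball_doubling:
  fixes \<nu> :: "'a::complete_space measure"
  assumes "doubling_space \<nu> C"
  shows "compact (cball (x :: 'a) R)"
  unfolding compact_eq_totally_bounded
  using doubling_space.finite_net[OF assms] by (auto simp: complete_eq_closed)

text \<open>The cutoffs are themselves admissible: they equal 1 on \<open>ball x0 \<rho>\<close>,
  their support lies in the compact \<open>cball x0 r\<close> with \<open>r < R\<close>, and since
  they take values in [0,1] their L^p term is at most the mass of \<open>ball x0 r\<close>.\<close>

lemma besov_capacities_eq_0:
  fixes \<nu> :: "'a::complete_space measure"
  assumes ds: "doubling_space \<nu> C" and p: "1 \<le> p"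
    and small: "\<And>R e. 0 < R \<Longrightarrow> 0 < e \<Longrightarrow> \<exists>r \<rho>. 0 < \<rho> \<and> \<rho> < r \<and> r < R \<and>
      besov_energy \<nu> \<theta> p (log_cutoff x0 r \<rho>) \<le> ennreal e \<and> measure \<nu> (ball x0 r) \<le> e"
  shows "besov_norm_capacity \<nu> \<theta> p {x0} = 0"
    and "0 < R \<Longrightarrow> besov_condenser_capacity \<nu> \<theta> p {x0} (ball x0 R) = 0"
proof -
  interpret doubling_space \<nu> C by (rule ds)
  have p': "0 < p" using p by simp
  have one_near: "one_near {x0} (log_cutoff x0 r \<rho>)" if "0 < \<rho>" "\<rho> < r" for r \<rho>
    unfolding one_near_def using that by (intro exI[of _ "ball x0 \<rho>"]) (auto intro!: log_cutoff_eq_1)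
  have "besov_norm_capacity \<nu> \<theta> p {x0} \<le> 0"
  proof (rule ennreal_le_epsilon)
    fix e :: real assume e: "0 < e"
    \<comment> \<open>The norm capacity does not restrict the support, so the bound 1 on the radius
      is arbitrary.\<close>
    obtain r \<rho> where \<rho>: "0 < \<rho>" "\<rho> < r"
      and E: "besov_energy \<nu> \<theta> p (log_cutoff x0 r \<rho>) \<le> ennreal (e / 2)" and r: "V x0 r \<le> e / 2"
      using small[of 1 "e / 2"] e by auto
    let ?u = "log_cutoff x0 r \<rho>"
    have "(\<integral>\<^sup>+x. ennreal (\<bar>?u x\<bar> powr p) \<partial>\<nu>) \<le> (\<integral>\<^sup>+x. indicator (ball x0 r) x \<partial>\<nu>)"
    proof (rule nn_integral_mono)
      fix x
      show "ennreal (\<bar>?u x\<bar> powr p) \<le> indicator (ball x0 r) x"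
      proof (cases "x \<in> ball x0 r")
        case True
        have "\<bar>?u x\<bar> powr p \<le> 1 powr p"
          using log_cutoff_bounds[OF \<rho>, of x0 x] p by (intro powr_mono2) auto
        then show ?thesis using True by simp
      qed (use \<rho> log_cutoff_eq_0[OF \<rho>, of x0 x] p in auto)
    qed
    also have "\<dots> \<le> ennreal (e / 2)" using r by (simp add: emeasure_ball ennreal_leI)
    finally have "besov_energy \<nu> \<theta> p ?u + (\<integral>\<^sup>+x. ennreal (\<bar>?u x\<bar> powr p) \<partial>\<nu>) \<le> ennreal (e / 2) + ennreal (e / 2)"
      using E by (intro add_mono)
    also have "\<dots> = ennreal e" using e by (simp add: ennreal_plus[symmetric] del: ennreal_plus)
    finally have le: "besov_energy \<nu> \<theta> p ?u + (\<integral>\<^sup>+x. ennreal (\<bar>?u x\<bar> powr p) \<partial>\<nu>) \<le> ennreal e" .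
    have "besov_norm_capacity \<nu> \<theta> p {x0} \<le> ennreal e"
      unfolding besov_norm_capacity_def besov_seminorm_powr[OF p'] Lp_norm_powr[OF p']
    proof (rule Inf_lower2[OF _ le], rule CollectI, rule exI[of _ ?u], intro conjI allI refl)
      show "besov_energy \<nu> \<theta> p ?u + (\<integral>\<^sup>+x. ennreal (\<bar>?u x\<bar> powr p) \<partial>\<nu>) < \<infinity>"
        by (rule le_less_trans[OF le]) simp
    qed (use one_near[OF \<rho>] log_cutoff_bounds[OF \<rho>] in auto)
    then show "besov_norm_capacity \<nu> \<theta> p {x0} \<le> 0 + ennreal e" by simp
  qed
  then show "besov_norm_capacity \<nu> \<theta> p {x0} = 0" by simp
  assume R: "0 < R"
  have "besov_condenser_capacity \<nu> \<theta> p {x0} (ball x0 R) \<le> 0"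
  proof (rule ennreal_le_epsilon)
    fix e :: real assume e: "0 < e"
    obtain r \<rho> where \<rho>: "0 < \<rho>" "\<rho> < r" and r: "r < R"
      and E: "besov_energy \<nu> \<theta> p (log_cutoff x0 r \<rho>) \<le> ennreal e"
      using small[OF R e] by auto
    let ?u = "log_cutoff x0 r \<rho>"
    have supp_le: "supp ?u \<subseteq> cball x0 r"
      unfolding supp_def
    proof (rule closure_minimal)
      show "{x. ?u x \<noteq> 0} \<subseteq> cball x0 r"
      proof
        fix x assume "x \<in> {x. ?u x \<noteq> 0}"
        then have "\<not> r \<le> dist x0 x" using log_cutoff_eq_0[OF \<rho>, of x0 x] by auto
        then show "x \<in> cball x0 r" by simp
      qed
    qed simp
    have closed: "closed (supp ?u)" by (simp add: supp_def)
    have "compact (supp ?u)"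
      using compact_Int_closed[OF compact_cball_doubling[OF ds] closed, of x0 r] supp_le
      by (simp add: Int_absorb1)
    then have inside: "supp ?u \<Subset> ball x0 R"
      using supp_le r closed by (auto simp: compactly_inside_def subset_iff)
    have "besov_condenser_capacity \<nu> \<theta> p {x0} (ball x0 R) \<le> ennreal e"
      unfolding besov_condenser_capacity_def besov_seminorm_powr[OF p']
      by (rule Inf_lower2[OF _ E], rule CollectI, rule exI[of _ ?u], intro conjI allI refl)
        (use one_near[OF \<rho>] log_cutoff_bounds[OF \<rho>] inside in auto)
    then show "besov_condenser_capacity \<nu> \<theta> p {x0} (ball x0 R) \<le> 0 + ennreal e" by simp
  qed
  then show "besov_condenser_capacity \<nu> \<theta> p {x0} (ball x0 R) = 0" by simp
qed

context doubling_space
begin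

section \<open>Radii at which the logarithmic cutoff has small energy\<close>

text \<open>Failure of the lower mass bound yields, for each \<open>c\<close>, a radius with
  \<open>V x0 r < c * r powr s\<close>. For the cutoff between \<open>r / 2\<close> and
  \<open>r\<close> the logarithm is just \<open>ln 2\<close>, and the energy is at most a constant
  times \<open>V x0 r / r powr s\<close>.\<close>

lemma small_energy_not_upper_S:
  assumes p: "1 \<le> p" and \<theta>: "0 < \<theta>" "\<theta> < 1" and S: "\<theta> * p \<notin> upper_S \<nu> x0"
    and R: "0 < R" and e: "0 < e"
  shows "\<exists>r \<rho>. 0 < \<rho> \<and> \<rho> < r \<and> r < R \<and>
      besov_energy \<nu> \<theta> p (log_cutoff x0 r \<rho>) \<le> ennreal e \<and> V x0 r \<le> e"
proof -
  obtain K where K: "0 < K" "\<And>x0 r \<rho>. 0 < \<rho> \<Longrightarrow> \<rho> < r \<Longrightarrow>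
    besov_energy \<nu> \<theta> p (log_cutoff x0 r \<rho>) \<le> ennreal (K / ln (r / \<rho>) powr p)
      * (\<integral>\<^sup>+x. ennreal (max \<rho> (dist x0 x) powr (- (\<theta> * p))) * indicator (ball x0 r) x \<partial>\<nu>)"
    using besov_energy_log_cutoff[OF p \<theta>] by blast
  define s where "s = \<theta> * p"
  have s: "0 < s" using p \<theta> by (simp add: s_def)
  define K' where "K' = K / ln 2 powr p * 2 powr s"
  have K': "0 < K'" using K by (simp add: K'_def)
  \<comment> \<open>The three bounds serve in turn the energy, the mass of the ball, and
    \<open>r < R\<close>: as \<open>r \<le> 1\<close>, the mass of \<open>ball x0 r\<close> is below
    \<open>c \<le> V x0 R\<close>.\<close>
  define c where "c = min (min (e / K') e) (V x0 R)"
  have c: "0 < c" "c \<le> e / K'" "c \<le> e" "c \<le> V x0 R" using e K' V_pos[OF R] by (auto simp: c_def)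
  obtain r where r: "0 < r" "r \<le> 1" and Vr: "V x0 r < c * r powr s"
    using S s c(1) by (auto simp: upper_S_def s_def not_le)
  have "r powr s \<le> 1 powr s" using r s by (intro powr_mono2) auto
  then have "c * r powr s \<le> c * 1" using c(1) by (intro mult_left_mono) auto
  then have Vr_c: "V x0 r < c" using Vr by simp
  have "r < R"
  proof (rule ccontr)
    assume "\<not> r < R"
    then have "V x0 R \<le> V x0 r" by (intro V_mono) auto
    then show False using Vr_c c by linarith
  qed
  have "(\<integral>\<^sup>+x. ennreal (max (r / 2) (dist x0 x) powr (- s)) * indicator (ball x0 r) x \<partial>\<nu>)
    \<le> (\<integral>\<^sup>+x. ennreal ((r / 2) powr (- s)) * indicator (ball x0 r) x \<partial>\<nu>)"
    using r s by (intro nn_integral_mono mult_right_mono ennreal_leI powr_mono2') auto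
  also have "\<dots> = ennreal ((r / 2) powr (- s) * V x0 r)"
    by (simp add: nn_integral_cmult_indicator emeasure_ball ennreal_mult')
  finally have W: "(\<integral>\<^sup>+x. ennreal (max (r / 2) (dist x0 x) powr (- s)) * indicator (ball x0 r) x \<partial>\<nu>)
    \<le> ennreal ((r / 2) powr (- s) * V x0 r)" .
  have "besov_energy \<nu> \<theta> p (log_cutoff x0 r (r / 2)) \<le> ennreal (K / ln (r / (r / 2)) powr p)
      * (\<integral>\<^sup>+x. ennreal (max (r / 2) (dist x0 x) powr (- s)) * indicator (ball x0 r) x \<partial>\<nu>)"
    unfolding s_def using r by (intro K(2)) auto
  also have "\<dots> \<le> ennreal (K / ln (r / (r / 2)) powr p) * ennreal ((r / 2) powr (- s) * V x0 r)"
    by (intro mult_left_mono W) auto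
  also have "\<dots> = ennreal (K / ln 2 powr p * ((r / 2) powr (- s) * V x0 r))"
    using r K by (subst ennreal_mult) auto
  also have "K / ln 2 powr p * ((r / 2) powr (- s) * V x0 r) = K' * (V x0 r / r powr s)"
    using r by (simp add: K'_def powr_divide powr_minus_divide)
  also have "ennreal \<dots> \<le> ennreal (K' * (e / K'))"
  proof (intro ennreal_leI mult_left_mono)
    have "V x0 r / r powr s \<le> c" using Vr r by (simp add: divide_simps)
    then show "V x0 r / r powr s \<le> e / K'" using c by linarith
  qed (use K' in auto)
  finally have "besov_energy \<nu> \<theta> p (log_cutoff x0 r (r / 2)) \<le> ennreal e" using K' by simp
  then show ?thesis using r \<open>r < R\<close> Vr_c c
    by (intro exI[of _ r] exI[of _ "r / 2"]) auto
qed

text \<open>Each dyadic scale between \<open>\<rho> = r / 2 ^ N\<close> and \<open>r\<close>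
  contributes a bounded amount to the weighted integral, so it grows at most linearly in
  \<open>N\<close>, while the logarithm in the denominator contributes \<open>N\<close> to the power
  \<open>p\<close>. The quotient is of order N^(1-p), which tends to 0 exactly because
  \<open>p > 1\<close>.\<close>

lemma small_energy_lower_S:
  assumes p: "1 < p" and \<theta>: "0 < \<theta>" "\<theta> < 1" and S: "\<theta> * p \<in> lower_S \<nu> x0"
    and R: "0 < R" and e: "0 < e"
  shows "\<exists>r \<rho>. 0 < \<rho> \<and> \<rho> < r \<and> r < R \<and>
      besov_energy \<nu> \<theta> p (log_cutoff x0 r \<rho>) \<le> ennreal e \<and> V x0 r \<le> e"
proof -
  have p1: "1 \<le> p" using p by simp
  obtain K where K: "0 < K" "\<And>x0 r \<rho>. 0 < \<rho> \<Longrightarrow> \<rho> < r \<Longrightarrow>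
    besov_energy \<nu> \<theta> p (log_cutoff x0 r \<rho>) \<le> ennreal (K / ln (r / \<rho>) powr p)
      * (\<integral>\<^sup>+x. ennreal (max \<rho> (dist x0 x) powr (- (\<theta> * p))) * indicator (ball x0 r) x \<partial>\<nu>)"
    using besov_energy_log_cutoff[OF p1 \<theta>] by blast
  define s where "s = \<theta> * p"
  have s: "0 < s" using p \<theta> by (simp add: s_def)
  obtain M where M: "0 < M" "\<And>r. 0 < r \<Longrightarrow> r \<le> 1 \<Longrightarrow> V x0 r \<le> M * r powr s"
    using S by (auto simp: lower_S_def s_def)
  \<comment> \<open>The entries give the range of the mass bound, \<open>r < R\<close>, and
    \<open>M * r powr s \<le> e\<close>.\<close>
  define r where "r = min (min 1 (R / 2)) ((e / M) powr (1 / s))"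
  have r: "0 < r" "r \<le> 1" "r < R" "r \<le> (e / M) powr (1 / s)"
    using R e M(1) by (auto simp: r_def min_less_iff_disj)
  have "r powr s \<le> ((e / M) powr (1 / s)) powr s" using r s by (intro powr_mono2) auto
  also have "\<dots> = e / M" using s e M(1) by (simp add: powr_powr)
  finally have "M * r powr s \<le> e" using M(1) by (simp add: divide_simps mult.commute)
  then have Vr: "V x0 r \<le> e" using M(2)[of r] r by linarith
  \<comment> \<open>The last factor 2 absorbs \<open>real N + 1 \<le> 2 * real N\<close>.\<close>
  define K' where "K' = K / ln 2 powr p * (M * 2 powr s) * 2"
  have K': "0 < K'" using K M(1) by (simp add: K'_def)
  have "(\<lambda>n. real n powr (1 - p)) \<longlonglongrightarrow> 0"
    using p by (intro tendsto_neg_powr filterlim_real_sequentially) auto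
  then have "\<forall>\<^sub>F n in sequentially. real n powr (1 - p) < e / K'"
    using e K' by (intro order_tendstoD) auto
  then have "\<forall>\<^sub>F n in sequentially. real n powr (1 - p) < e / K' \<and> 0 < n"
    using eventually_gt_at_top[of 0] by eventually_elim auto
  then have "\<exists>n. real n powr (1 - p) < e / K' \<and> 0 < n"
    by (rule eventually_happens'[OF sequentially_bot])
  then obtain N where N: "real N powr (1 - p) < e / K'" "0 < N" by blast
  define \<rho> where "\<rho> = r / 2 ^ N"
  have \<rho>: "0 < \<rho>" "\<rho> < r" using r N by (auto simp: \<rho>_def divide_simps)
  \<comment> \<open>If \<open>x\<close> lies in the ball of radius \<open>r / 2 ^ n\<close>, the
    summand \<open>k = n\<close> alone dominates level \<open>Suc n\<close>; otherwise the maximum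
    does not change from level \<open>n\<close>. Summing up to and including \<open>n\<close> gives
    the base case its single term.\<close>
  have pointwise: "ennreal (max (r / 2 ^ n) (dist x0 x) powr (- s)) * indicator (ball x0 r) x
    \<le> (\<Sum>k\<le>n. ennreal ((r / 2 ^ Suc k) powr (- s)) * indicator (ball x0 (r / 2 ^ k)) x)" for n x
  proof (induction n)
    case 0
    show ?case using r s by (auto intro!: mult_right_mono ennreal_leI powr_mono2')
  next
    case (Suc n)
    show ?case
    proof (cases "dist x0 x < r / 2 ^ n")
      case True
      have "ennreal (max (r / 2 ^ Suc n) (dist x0 x) powr (- s)) * indicator (ball x0 r) x
        \<le> ennreal ((r / 2 ^ Suc n) powr (- s)) * indicator (ball x0 (r / 2 ^ n)) x"
      proof -
        have "max (r / 2 ^ Suc n) (dist x0 x) powr (- s) \<le> (r / 2 ^ Suc n) powr (- s)"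
          using r s by (intro powr_mono2') auto
        then show ?thesis using True by (auto intro!: ennreal_leI split: split_indicator)
      qed
      also have "\<dots> \<le> (\<Sum>k\<le>n. ennreal ((r / 2 ^ Suc k) powr (- s)) * indicator (ball x0 (r / 2 ^ k)) x)"
        by (rule member_le_sum) auto
      also have "\<dots> \<le> (\<Sum>k\<le>Suc n. ennreal ((r / 2 ^ Suc k) powr (- s)) * indicator (ball x0 (r / 2 ^ k)) x)"
        by simp
      finally show ?thesis .
    next
      case False
      have "r / 2 ^ Suc n \<le> r / 2 ^ n" using r by (intro divide_left_mono) auto
      then have "max (r / 2 ^ Suc n) (dist x0 x) = max (r / 2 ^ n) (dist x0 x)"
        using False by linarith
      then have "ennreal (max (r / 2 ^ Suc n) (dist x0 x) powr (- s)) * indicator (ball x0 r) x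
        \<le> (\<Sum>k\<le>n. ennreal ((r / 2 ^ Suc k) powr (- s)) * indicator (ball x0 (r / 2 ^ k)) x)"
        using Suc.IH by simp
      also have "\<dots> \<le> (\<Sum>k\<le>Suc n. ennreal ((r / 2 ^ Suc k) powr (- s)) * indicator (ball x0 (r / 2 ^ k)) x)"
        by simp
      finally show ?thesis .
    qed
  qed
  have "(\<integral>\<^sup>+x. ennreal (max \<rho> (dist x0 x) powr (- s)) * indicator (ball x0 r) x \<partial>\<nu>)
    \<le> (\<integral>\<^sup>+x. (\<Sum>k\<le>N. ennreal ((r / 2 ^ Suc k) powr (- s)) * indicator (ball x0 (r / 2 ^ k)) x) \<partial>\<nu>)"
    unfolding \<rho>_def by (intro nn_integral_mono pointwise)
  also have "\<dots> = (\<Sum>k\<le>N. ennreal ((r / 2 ^ Suc k) powr (- s)) * ennreal (V x0 (r / 2 ^ k)))"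
    by (subst nn_integral_sum) (auto simp: nn_integral_cmult_indicator emeasure_ball)
  also have "\<dots> \<le> (\<Sum>k\<le>N. ennreal (M * 2 powr s))"
  proof (rule sum_mono)
    fix k
    define t where "t = r / 2 ^ k"
    have "r / 2 ^ k \<le> r / 1" using r by (intro divide_left_mono) auto
    then have t: "0 < t" "t \<le> 1" using r unfolding t_def by (simp, linarith)
    have "(t / 2) powr (- s) * V x0 t \<le> (t / 2) powr (- s) * (M * t powr s)"
      by (intro mult_left_mono M(2) t) auto
    also have "\<dots> = M * 2 powr s" using t by (simp add: powr_divide powr_minus_divide)
    finally have "ennreal ((t / 2) powr (- s) * V x0 t) \<le> ennreal (M * 2 powr s)" by (rule ennreal_leI)
    then show "ennreal ((r / 2 ^ Suc k) powr (- s)) * ennreal (V x0 (r / 2 ^ k)) \<le> ennreal (M * 2 powr s)"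
      by (simp add: t_def ennreal_mult mult.commute)
  qed
  also have "\<dots> = ennreal ((real N + 1) * (M * 2 powr s))"
    using M(1) by (simp add: ennreal_of_nat_eq_real_of_nat ennreal_mult[symmetric] ennreal_plus[symmetric] add.commute flip: ennreal_1 del: ennreal_plus)
  finally have W: "(\<integral>\<^sup>+x. ennreal (max \<rho> (dist x0 x) powr (- s)) * indicator (ball x0 r) x \<partial>\<nu>)
    \<le> ennreal ((real N + 1) * (M * 2 powr s))" .
  have L: "ln (r / \<rho>) = real N * ln 2" using r by (simp add: \<rho>_def ln_realpow)
  have "besov_energy \<nu> \<theta> p (log_cutoff x0 r \<rho>) \<le> ennreal (K / ln (r / \<rho>) powr p)
      * (\<integral>\<^sup>+x. ennreal (max \<rho> (dist x0 x) powr (- s)) * indicator (ball x0 r) x \<partial>\<nu>)"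
    unfolding s_def by (intro K(2) \<rho>)
  also have "\<dots> \<le> ennreal (K / ln (r / \<rho>) powr p) * ennreal ((real N + 1) * (M * 2 powr s))"
    by (intro mult_left_mono W) auto
  also have "\<dots> = ennreal (K / (real N * ln 2) powr p * ((real N + 1) * (M * 2 powr s)))"
    unfolding L using M(1) K by (subst ennreal_mult) auto
  also have "\<dots> \<le> ennreal e"
  proof (rule ennreal_leI)
    have "K / (real N * ln 2) powr p * ((real N + 1) * (M * 2 powr s))
      \<le> K / (real N * ln 2) powr p * ((2 * real N) * (M * 2 powr s))"
      using K M(1) N by (intro mult_left_mono mult_right_mono) auto
    also have "\<dots> = K' * real N powr (1 - p)"
      using N(2) by (simp add: K'_def powr_mult powr_diff mult_ac)
    also have "\<dots> \<le> K' * (e / K')" using N K' by (intro mult_left_mono) auto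
    finally show "K / (real N * ln 2) powr p * ((real N + 1) * (M * 2 powr s)) \<le> e" using K' by simp
  qed
  finally show ?thesis using \<rho> r Vr by (intro exI[of _ r] exI[of _ \<rho>]) auto
qed

end

subsection \<open>Positive capacities\<close>

context doubling_space
begin

text \<open>\<open>enn2real\<close> would send an infinite integral to 0; for \<open>u\<close>
  between 0 and 1 on a ball the integral is finite, so this is the true mean value.\<close>

definition average :: "('a \<Rightarrow> real) \<Rightarrow> 'a set \<Rightarrow> real" where
  "average u A = enn2real (\<integral>\<^sup>+x. ennreal (u x) * indicator A x \<partial>\<nu>) / measure \<nu> A"

lemma nn_integral_ball_average:
  assumes r: "0 < r" and [measurable]: "u \<in> borel_measurable \<nu>" and u: "\<And>x. 0 \<le> u x \<and> u x \<le> 1"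
  shows "(\<integral>\<^sup>+x. ennreal (u x) * indicator (ball a r) x \<partial>\<nu>) = ennreal (V a r * average u (ball a r))"
proof -
  have "(\<integral>\<^sup>+x. ennreal (u x) * indicator (ball a r) x \<partial>\<nu>) \<le> (\<integral>\<^sup>+x. indicator (ball a r) x \<partial>\<nu>)"
    using u by (intro nn_integral_mono) (auto split: split_indicator simp: ennreal_le_1)
  also have "\<dots> < \<infinity>" by (simp add: emeasure_ball)
  finally show ?thesis using V_pos[OF r, of a] by (simp add: average_def)
qed

lemma average_nonneg: "0 \<le> average u A"
  by (simp add: average_def)

lemma average_eq_1:
  assumes "0 < r" "\<And>x. x \<in> ball a r \<Longrightarrow> u x = 1"
  shows "average u (ball a r) = 1"
proof -
  have "(\<integral>\<^sup>+x. ennreal (u x) * indicator (ball a r) x \<partial>\<nu>) = (\<integral>\<^sup>+x. indicator (ball a r) x \<partial>\<nu>)"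
    using assms(2) by (intro nn_integral_cong) (auto split: split_indicator)
  then show ?thesis using V_pos[OF assms(1), of a] by (simp add: average_def emeasure_ball)
qed

lemma average_eq_0:
  assumes "\<And>x. x \<in> A \<Longrightarrow> u x = 0"
  shows "average u A = 0"
proof -
  have "(\<integral>\<^sup>+x. ennreal (u x) * indicator A x \<partial>\<nu>) = (\<integral>\<^sup>+x. 0 \<partial>\<nu>)"
    using assms by (intro nn_integral_cong) (auto split: split_indicator)
  then show ?thesis by (simp add: average_def)
qed

text \<open>Substitute for a fractional Poincare inequality: integrate \<open>u x \<le> u y + l + l
  powr (1 - p) * \<bar>u x - u y\<bar> powr p\<close> over the product of the balls and divide by
  its mass. The balls need not be concentric, so a ball on which \<open>u\<close> vanishes can be
  the second one.\<close>

lemma average_le_average: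
  assumes p: "1 \<le> p" and \<theta>: "0 < \<theta>" and l: "0 < l" and r: "0 < r" "0 < r'"
    and K: "ball a r \<subseteq> ball x0 K" "ball b r' \<subseteq> ball x0 K"
    and u_meas [measurable]: "u \<in> borel_measurable \<nu>" and u: "\<And>x. 0 \<le> u x \<and> u x \<le> 1"
    and j: "besov_energy \<nu> \<theta> p u = ennreal j" "0 \<le> j"
  shows "average u (ball a r) \<le> average u (ball b r')
    + (l + l powr (1 - p) * ((2 * K) powr (\<theta> * p) * V x0 (3 * K)) / (V a r * V b r') * j)"
proof -
  interpret sigma_finite_measure \<nu> by (rule sigma_finite)
  define A B where "A = ball a r" and "B = ball b r'"
  have [measurable]: "A \<in> sets \<nu>" "B \<in> sets \<nu>" by (auto simp: A_def B_def)
  have emA: "emeasure \<nu> A = ennreal (V a r)" and emB: "emeasure \<nu> B = ennreal (V b r')"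
    by (auto simp: A_def B_def emeasure_ball)
  have VA: "0 < V a r" and VB: "0 < V b r'" using r by (auto intro: V_pos)
  define \<alpha> \<beta> where "\<alpha> = average u A" and "\<beta> = average u B"
  have nn: "0 \<le> \<alpha>" "0 \<le> \<beta>" by (auto simp: \<alpha>_def \<beta>_def average_nonneg)
  have UA: "(\<integral>\<^sup>+x. ennreal (u x) * indicator A x \<partial>\<nu>) = ennreal (V a r * \<alpha>)"
    unfolding A_def \<alpha>_def by (rule nn_integral_ball_average[OF r(1) u_meas u])
  have UB: "(\<integral>\<^sup>+x. ennreal (u x) * indicator B x \<partial>\<nu>) = ennreal (V b r' * \<beta>)"
    unfolding B_def \<beta>_def by (rule nn_integral_ball_average[OF r(2) u_meas u])
  define k where "k = l powr (1 - p)"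
  \<comment> \<open>Two points of \<open>ball x0 K\<close> are at distance below
    \<open>2 * K\<close>, and the ball in the kernel lies in \<open>ball x0 (3 * K)\<close>; so
    \<open>D\<close> bounds the denominator of the Besov integrand.\<close>
  define D where "D = (2 * K) powr (\<theta> * p) * V x0 (3 * K)"
  have k: "0 < k" using l by (simp add: k_def)
  have D: "0 \<le> D" by (simp add: D_def)
  define ind where "ind x y = (indicator A x * indicator B y :: ennreal)" for x y
  define f1 where "f1 z = ennreal (u (fst z)) * ind (fst z) (snd z)" for z
  define f2 where "f2 z = ennreal (u (snd z)) * ind (fst z) (snd z)" for z
  define f3 where "f3 z = ennreal l * ind (fst z) (snd z)" for z
  define f4 where "f4 z = ennreal (\<bar>u (fst z) - u (snd z)\<bar> powr p) * ind (fst z) (snd z)" for z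
  have [measurable]: "f1 \<in> borel_measurable (\<nu> \<Otimes>\<^sub>M \<nu>)" "f2 \<in> borel_measurable (\<nu> \<Otimes>\<^sub>M \<nu>)"
    "f3 \<in> borel_measurable (\<nu> \<Otimes>\<^sub>M \<nu>)" "f4 \<in> borel_measurable (\<nu> \<Otimes>\<^sub>M \<nu>)"
    unfolding f1_def[abs_def] f2_def[abs_def] f3_def[abs_def] f4_def[abs_def] ind_def by measurable
  have i1: "(\<integral>\<^sup>+z. f1 z \<partial>(\<nu> \<Otimes>\<^sub>M \<nu>)) = ennreal (V a r * \<alpha>) * ennreal (V b r')"
  proof -
    have "(\<integral>\<^sup>+z. f1 z \<partial>(\<nu> \<Otimes>\<^sub>M \<nu>)) = (\<integral>\<^sup>+x. \<integral>\<^sup>+y. (ennreal (u x) * indicator A x) * indicator B y \<partial>\<nu> \<partial>\<nu>)"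
      by (subst nn_integral_fst[symmetric]) (auto simp: f1_def ind_def mult.assoc)
    also have "\<dots> = (\<integral>\<^sup>+x. (ennreal (u x) * indicator A x) * ennreal (V b r') \<partial>\<nu>)"
      by (simp add: nn_integral_cmult_indicator emB)
    finally show ?thesis by (simp add: nn_integral_multc UA)
  qed
  have i2: "(\<integral>\<^sup>+z. f2 z \<partial>(\<nu> \<Otimes>\<^sub>M \<nu>)) = ennreal (V a r) * ennreal (V b r' * \<beta>)"
  proof -
    have "(\<integral>\<^sup>+z. f2 z \<partial>(\<nu> \<Otimes>\<^sub>M \<nu>)) = (\<integral>\<^sup>+x. \<integral>\<^sup>+y. indicator A x * (ennreal (u y) * indicator B y) \<partial>\<nu> \<partial>\<nu>)"
      by (subst nn_integral_fst[symmetric]) (auto simp: f2_def ind_def mult_ac)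
    also have "\<dots> = (\<integral>\<^sup>+x. indicator A x * ennreal (V b r' * \<beta>) \<partial>\<nu>)"
      by (simp add: nn_integral_cmult UB)
    finally show ?thesis by (simp add: nn_integral_multc emA)
  qed
  have i3: "(\<integral>\<^sup>+z. f3 z \<partial>(\<nu> \<Otimes>\<^sub>M \<nu>)) = ennreal l * (ennreal (V a r) * ennreal (V b r'))"
  proof -
    have "(\<integral>\<^sup>+z. f3 z \<partial>(\<nu> \<Otimes>\<^sub>M \<nu>)) = (\<integral>\<^sup>+x. \<integral>\<^sup>+y. (ennreal l * indicator A x) * indicator B y \<partial>\<nu> \<partial>\<nu>)"
      by (subst nn_integral_fst[symmetric]) (auto simp: f3_def ind_def mult_ac)
    also have "\<dots> = (\<integral>\<^sup>+x. (ennreal l * indicator A x) * ennreal (V b r') \<partial>\<nu>)"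
      by (simp add: nn_integral_cmult_indicator emB)
    finally show ?thesis by (simp add: nn_integral_multc nn_integral_cmult_indicator emA mult.assoc nn_integral_cmult)
  qed
  have kernel: "ennreal (\<bar>u x - u y\<bar> powr p) * ind x y \<le> ennreal D * (if x = y then 0
           else ennreal (\<bar>u x - u y\<bar> powr p / dist x y powr (\<theta> * p) / V x (dist x y)))" for x y
  proof (cases "x \<in> A \<and> y \<in> B \<and> x \<noteq> y")
    case True
    then have xy: "dist x0 x < K" "dist x0 y < K" using K by (auto simp: A_def B_def subset_iff)
    then have d: "dist x y < 2 * K" using dist_triangle[of x y x0] by (simp add: dist_commute)
    have "ball x (dist x y) \<subseteq> ball x0 (3 * K)"
    proof
      fix z assume "z \<in> ball x (dist x y)"
      then show "z \<in> ball x0 (3 * K)" using d xy dist_triangle[of x0 z x] by simp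
    qed
    then have "V x (dist x y) \<le> V x0 (3 * K)" by (rule V_mono)
    moreover have "dist x y powr (\<theta> * p) \<le> (2 * K) powr (\<theta> * p)"
      using d \<theta> p by (intro powr_mono2) auto
    ultimately have "dist x y powr (\<theta> * p) * V x (dist x y) \<le> D"
      unfolding D_def by (intro mult_mono) auto
    moreover have "0 < dist x y powr (\<theta> * p) * V x (dist x y)"
      using True by (intro mult_pos_pos V_pos) auto
    ultimately have "1 \<le> D / (dist x y powr (\<theta> * p) * V x (dist x y))" by simp
    then have "\<bar>u x - u y\<bar> powr p * 1 \<le> \<bar>u x - u y\<bar> powr p * (D / (dist x y powr (\<theta> * p) * V x (dist x y)))"
      by (intro mult_left_mono) auto
    then have "\<bar>u x - u y\<bar> powr p \<le> D * (\<bar>u x - u y\<bar> powr p / dist x y powr (\<theta> * p) / V x (dist x y))"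
      by (simp add: mult_ac)
    then show ?thesis using True D
      by (simp add: ind_def ennreal_mult[symmetric] ennreal_leI)
  next
    case False
    then show ?thesis using p by (auto simp: ind_def)
  qed
  \<comment> \<open>For \<open>D = 0\<close> the kernel bound forces \<open>f4 = 0\<close>.
    Otherwise \<open>D\<close> is moved to the side of \<open>f4\<close>, whose measurability is
    established, and the energy enters through monotonicity alone.\<close>
  have i4: "(\<integral>\<^sup>+z. f4 z \<partial>(\<nu> \<Otimes>\<^sub>M \<nu>)) \<le> ennreal (D * j)"
  proof (cases "D = 0")
    case True
    have "(\<integral>\<^sup>+z. f4 z \<partial>(\<nu> \<Otimes>\<^sub>M \<nu>)) \<le> (\<integral>\<^sup>+z. 0 \<partial>(\<nu> \<Otimes>\<^sub>M \<nu>))"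
    proof (rule nn_integral_mono)
      fix z
      show "f4 z \<le> 0" using kernel[of "fst z" "snd z"] True by (simp add: f4_def)
    qed
    then show ?thesis by simp
  next
    case False
    then have D_pos: "0 < D" using D by simp
    have "ennreal (1 / D) * (\<integral>\<^sup>+z. f4 z \<partial>(\<nu> \<Otimes>\<^sub>M \<nu>)) = (\<integral>\<^sup>+z. ennreal (1 / D) * f4 z \<partial>(\<nu> \<Otimes>\<^sub>M \<nu>))"
      by (simp add: nn_integral_cmult)
    also have "\<dots> = (\<integral>\<^sup>+x. \<integral>\<^sup>+y. ennreal (1 / D) * f4 (x, y) \<partial>\<nu> \<partial>\<nu>)"
      by (rule nn_integral_fst[symmetric]) measurable
    also have "\<dots> \<le> besov_energy \<nu> \<theta> p u"
      unfolding besov_energy_def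
    proof (intro nn_integral_mono)
      fix x y
      let ?e = "(if x = y then 0
           else ennreal (\<bar>u x - u y\<bar> powr p / dist x y powr (\<theta> * p) / V x (dist x y)))"
      have "ennreal (1 / D) * f4 (x, y) \<le> ennreal (1 / D) * (ennreal D * ?e)"
        using kernel[of x y] by (intro mult_left_mono) (auto simp: f4_def)
      also have "\<dots> = ?e" using D_pos by (simp add: mult.assoc[symmetric] ennreal_mult[symmetric])
      finally show "ennreal (1 / D) * f4 (x, y) \<le> ?e" .
    qed
    finally have "ennreal D * (ennreal (1 / D) * (\<integral>\<^sup>+z. f4 z \<partial>(\<nu> \<Otimes>\<^sub>M \<nu>))) \<le> ennreal D * ennreal j"
      unfolding j(1) by (intro mult_left_mono) auto
    then show ?thesis using D_pos j(2)
      by (simp add: mult.assoc[symmetric] ennreal_mult[symmetric])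
  qed
  have "ennreal (V a r * \<alpha> * V b r') = (\<integral>\<^sup>+z. f1 z \<partial>(\<nu> \<Otimes>\<^sub>M \<nu>))"
    using nn by (simp add: i1 ennreal_mult)
  also have "\<dots> \<le> (\<integral>\<^sup>+z. f2 z + f3 z + ennreal k * f4 z \<partial>(\<nu> \<Otimes>\<^sub>M \<nu>))"
  proof (rule nn_integral_mono)
    fix z :: "'a \<times> 'a"
    obtain x y where z: "z = (x, y)" by (cases z)
    have "u x \<le> u y + l + k * \<bar>u x - u y\<bar> powr p"
      using le_add_powr[of "\<bar>u x - u y\<bar>" l p] l p by (simp add: k_def)
    then have "ennreal (u x) \<le> ennreal (u y) + ennreal l + ennreal k * ennreal (\<bar>u x - u y\<bar> powr p)"
      using u l k by (simp add: ennreal_mult[symmetric] ennreal_plus[symmetric] ennreal_leI del: ennreal_plus)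
    then have "ennreal (u x) * ind x y \<le> (ennreal (u y) + ennreal l + ennreal k * ennreal (\<bar>u x - u y\<bar> powr p)) * ind x y"
      by (intro mult_right_mono) auto
    then show "f1 z \<le> f2 z + f3 z + ennreal k * f4 z"
      by (simp add: f1_def f2_def f3_def f4_def z distrib_right mult.assoc)
  qed
  also have "\<dots> = (\<integral>\<^sup>+z. f2 z \<partial>(\<nu> \<Otimes>\<^sub>M \<nu>)) + (\<integral>\<^sup>+z. f3 z \<partial>(\<nu> \<Otimes>\<^sub>M \<nu>)) + ennreal k * (\<integral>\<^sup>+z. f4 z \<partial>(\<nu> \<Otimes>\<^sub>M \<nu>))"
    by (simp add: nn_integral_add nn_integral_cmult)
  also have "\<dots> \<le> ennreal (V a r) * ennreal (V b r' * \<beta>) + ennreal l * (ennreal (V a r) * ennreal (V b r')) + ennreal k * ennreal (D * j)"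
    unfolding i2 i3 by (intro add_mono mult_left_mono i4) auto
  also have "\<dots> = ennreal (V a r * (V b r' * \<beta>) + l * (V a r * V b r') + k * (D * j))"
    using l k D j(2) nn by (simp add: ennreal_mult[symmetric] ennreal_plus[symmetric] del: ennreal_plus)
  finally have "V a r * \<alpha> * V b r' \<le> V a r * (V b r' * \<beta>) + l * (V a r * V b r') + k * (D * j)"
    using l k D j(2) nn by (subst (asm) ennreal_le_iff) auto
  moreover define P where "P = V a r * V b r'"
  ultimately have "\<alpha> * P \<le> \<beta> * P + l * P + k * D * j" by (simp add: mult_ac)
  moreover have P: "0 < P" using VA VB by (simp add: P_def)
  ultimately have "\<alpha> \<le> (\<beta> * P + l * P + k * D * j) / P" by (simp only: pos_le_divide_eq)
  also have "\<dots> = \<beta> + (l + k * D / P * j)" using P by (simp add: add_divide_distrib)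
  finally have "\<alpha> \<le> \<beta> + (l + k * D / P * j)" .
  then show ?thesis by (simp add: \<alpha>_def \<beta>_def A_def B_def k_def D_def P_def)
qed

section \<open>Summation over dyadic scales\<close>

text \<open>Consecutive averages over the balls of radius \<open>1 / 2 ^ k\<close> differ by a
  geometrically small amount, because \<open>s < \<theta> * p\<close> leaves a positive power of the
  radius. The sum is therefore bounded independently of how small the neighbourhood is on which
  \<open>u = 1\<close>.\<close>

lemma average_telescope:
  assumes p: "1 \<le> p" and \<theta>: "0 < \<theta>" and s: "s \<in> upper_S \<nu> x0" "s < \<theta> * p"
  obtains M where "0 < M" "\<And>u e j. u \<in> borel_measurable \<nu> \<Longrightarrow> (\<And>x. 0 \<le> u x \<and> u x \<le> 1) \<Longrightarrow> 0 < e \<Longrightarrow>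
    (\<And>x. x \<in> ball x0 e \<Longrightarrow> u x = 1) \<Longrightarrow> besov_energy \<nu> \<theta> p u = ennreal j \<Longrightarrow> 0 \<le> j \<Longrightarrow>
    3 / 4 \<le> average u (ball x0 1) + M * j"
proof -
  obtain c where c: "0 < c" "\<And>r. 0 < r \<Longrightarrow> r \<le> 1 \<Longrightarrow> c * r powr s \<le> V x0 r"
    using s(1) by (auto simp: upper_S_def)
  \<comment> \<open>Chosen so that \<open>q powr p = 2 powr (- (\<theta> * p - s))\<close>. With
    \<open>l = \<eta> * q ^ k\<close> the energy term then decays like \<open>q ^ k\<close> too,
    because \<open>(q ^ k) powr (1 - p) * (q ^ k) powr p = q ^ k\<close>.\<close>
  define q where "q = 2 powr (- ((\<theta> * p - s) / p))"
  have q: "0 < q" "q < 1" using s(2) p by (auto simp: q_def powr_less_one)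
  \<comment> \<open>The terms \<open>\<eta> * q ^ k\<close> sum to at most 1/4, the loss allowed by
    the value 3/4.\<close>
  define \<eta> where "\<eta> = (1 - q) / 4"
  have \<eta>: "0 < \<eta>" using q by (simp add: \<eta>_def)
  \<comment> \<open>The power of 2 comes from the distance bound \<open>2 * K\<close>, the cube from
    two doublings covering \<open>3 * K\<close> and one from \<open>K / 2\<close> to
    \<open>K\<close>, and \<open>1 / c\<close> from the lower mass bound.\<close>
  define D where "D = 2 powr (\<theta> * p) * C ^ 3 / c"
  have D: "0 < D" using c C_gt_1 by (simp add: D_def)
  define M where "M = \<eta> powr (1 - p) * D / (1 - q)"
  show ?thesis
  proof (rule that[of M])
    show "0 < M" using \<eta> D q by (simp add: M_def)
    fix u e j
    assume u: "u \<in> borel_measurable \<nu>" "\<And>x. 0 \<le> u x \<and> u x \<le> 1" and e: "0 < e"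
      and one: "\<And>x. x \<in> ball x0 e \<Longrightarrow> u x = 1"
      and j: "besov_energy \<nu> \<theta> p u = ennreal j" "0 \<le> j"
    define a where "a k = average u (ball x0 (1 / 2 ^ k))" for k :: nat
    have step: "a (Suc k) \<le> a k + (\<eta> + \<eta> powr (1 - p) * D * j) * q ^ k" for k
    proof -
      define K where "K = (1 / 2 ^ k :: real)"
      have K: "0 < K" "K \<le> 1" by (auto simp: K_def)
      define l where "l = \<eta> * q ^ k"
      have l: "0 < l" using \<eta> q by (simp add: l_def)
      have "average u (ball x0 (K / 2)) \<le> average u (ball x0 K)
        + (l + l powr (1 - p) * ((2 * K) powr (\<theta> * p) * V x0 (3 * K)) / (V x0 (K / 2) * V x0 K) * j)"
        using K by (intro average_le_average p \<theta> l u j) auto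
      also have "\<dots> \<le> average u (ball x0 K) + (l + l powr (1 - p) * (D * K powr (\<theta> * p - s)) * j)"
      proof -
        have v: "0 < V x0 K" "0 < V x0 (K / 2)" using K by (auto intro: V_pos)
        have "V x0 (3 * K) \<le> V x0 (2 ^ 2 * K)" using K by (intro V_mono) auto
        also have "\<dots> \<le> C ^ 2 * V x0 K" using K by (intro V_iterate)
        also have "\<dots> \<le> C ^ 2 * (C * V x0 (K / 2))"
          using doubling[of "K / 2" x0] K C_gt_1 by (intro mult_left_mono) auto
        finally have V3: "V x0 (3 * K) \<le> C ^ 3 * V x0 (K / 2)" by (simp add: power2_eq_square power3_eq_cube mult.assoc)
        have "(2 * K) powr (\<theta> * p) * V x0 (3 * K) / (V x0 (K / 2) * V x0 K)
          \<le> (2 * K) powr (\<theta> * p) * (C ^ 3 * V x0 (K / 2)) / (V x0 (K / 2) * V x0 K)"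
          using V3 v by (intro divide_right_mono mult_left_mono) auto
        also have "\<dots> = (2 * K) powr (\<theta> * p) * C ^ 3 / V x0 K" using v by simp
        also have "\<dots> \<le> (2 * K) powr (\<theta> * p) * C ^ 3 / (c * K powr s)"
          using c(1) c(2)[OF K] K C_gt_1 v by (intro divide_left_mono mult_pos_pos) auto
        also have "\<dots> = D * K powr (\<theta> * p - s)"
          using K by (simp add: D_def powr_mult powr_diff)
        finally have "l powr (1 - p) * ((2 * K) powr (\<theta> * p) * V x0 (3 * K) / (V x0 (K / 2) * V x0 K)) * j
          \<le> l powr (1 - p) * (D * K powr (\<theta> * p - s)) * j"
          using j(2) by (intro mult_right_mono mult_left_mono) auto
        then show ?thesis by simp
      qed
      also have "l powr (1 - p) * (D * K powr (\<theta> * p - s)) * j = \<eta> powr (1 - p) * D * j * q ^ k"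
      proof -
        have "K powr (\<theta> * p - s) = (q ^ k) powr p"
          using p by (simp add: K_def q_def powr_divide powr_realpow[symmetric] powr_powr powr_minus_divide mult_ac)
        moreover have "l powr (1 - p) = \<eta> powr (1 - p) * (q ^ k) powr (1 - p)"
          using \<eta> q by (simp add: l_def powr_mult)
        moreover have "(q ^ k) powr (1 - p) * (q ^ k) powr p = q ^ k"
          using q by (simp add: powr_add[symmetric])
        ultimately show ?thesis by (metis (no_types, opaque_lifting) mult.assoc mult.commute)
      qed
      finally show ?thesis by (simp add: a_def K_def l_def algebra_simps)
    qed
    define T where "T = \<eta> + \<eta> powr (1 - p) * D * j"
    have T: "0 \<le> T" using \<eta> D j(2) by (simp add: T_def)
    have sum: "a n \<le> a 0 + T * (\<Sum>k<n. q ^ k)" for n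
    proof (induction n)
      case (Suc n)
      then show ?case using step[of n] by (simp add: T_def[symmetric] distrib_left)
    qed simp
    \<comment> \<open>The size \<open>e\<close> of the neighbourhood determines only the number of
      summands, never \<open>M\<close>.\<close>
    obtain n where n: "1 / 2 ^ n < e"
      using real_arch_pow_inv[OF e, of "1 / 2"] by (auto simp: power_one_over)
    have "a n = 1" unfolding a_def using n by (intro average_eq_1 one) auto
    then have "1 \<le> a 0 + T * (\<Sum>k<n. q ^ k)" using sum[of n] by simp
    also have "\<dots> \<le> a 0 + T * (1 / (1 - q))"
    proof (intro add_left_mono mult_left_mono T)
      have "(\<Sum>k<n. q ^ k) \<le> (\<Sum>k. q ^ k)" using q by (intro sum_le_suminf summable_geometric) auto
      also have "\<dots> = 1 / (1 - q)" using q by (intro suminf_geometric) auto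
      finally show "(\<Sum>k<n. q ^ k) \<le> 1 / (1 - q)" .
    qed
    also have "\<dots> = a 0 + 1 / 4 + M * j"
      using q by (simp add: T_def M_def \<eta>_def divide_simps) (simp add: algebra_simps)
    finally show "3 / 4 \<le> average u (ball x0 1) + M * j" by (simp add: a_def)
  qed
qed

text \<open>The same splitting, applied to \<open>u\<close> itself: the constant \<open>l\<close> is
  integrated over the ball and the p-th power over the whole space.\<close>

lemma average_le_Lp:
  assumes p: "1 \<le> p" and [measurable]: "u \<in> borel_measurable \<nu>" and u: "\<And>x. 0 \<le> u x \<and> u x \<le> 1"
    and l: "0 < l" and r: "0 < r" and n: "(\<integral>\<^sup>+x. ennreal (\<bar>u x\<bar> powr p) \<partial>\<nu>) = ennreal n" "0 \<le> n"
  shows "average u (ball a r) \<le> l + l powr (1 - p) / V a r * n"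
proof -
  have "ennreal (V a r * average u (ball a r)) = (\<integral>\<^sup>+x. ennreal (u x) * indicator (ball a r) x \<partial>\<nu>)"
    using r u by (subst nn_integral_ball_average) auto
  also have "\<dots> \<le> (\<integral>\<^sup>+x. ennreal l * indicator (ball a r) x + ennreal (l powr (1 - p)) * ennreal (\<bar>u x\<bar> powr p) \<partial>\<nu>)"
  proof (rule nn_integral_mono)
    fix x
    have "u x \<le> l + l powr (1 - p) * \<bar>u x\<bar> powr p"
      using le_add_powr[of "u x" l p] u[of x] l p by simp
    then have "ennreal (u x) \<le> ennreal l + ennreal (l powr (1 - p)) * ennreal (\<bar>u x\<bar> powr p)"
      using l by (simp add: ennreal_mult[symmetric] ennreal_plus[symmetric] ennreal_leI del: ennreal_plus)
    then show "ennreal (u x) * indicator (ball a r) x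
      \<le> ennreal l * indicator (ball a r) x + ennreal (l powr (1 - p)) * ennreal (\<bar>u x\<bar> powr p)"
      by (simp split: split_indicator)
  qed
  also have "\<dots> = ennreal l * ennreal (V a r) + ennreal (l powr (1 - p)) * ennreal n"
    by (simp add: nn_integral_add nn_integral_cmult nn_integral_cmult_indicator emeasure_ball n)
  also have "\<dots> = ennreal (l * V a r + l powr (1 - p) * n)"
    using l n(2) by (simp add: ennreal_mult[symmetric] ennreal_plus[symmetric] del: ennreal_plus)
  finally have "V a r * average u (ball a r) \<le> l * V a r + l powr (1 - p) * n"
    using l n(2) by (subst (asm) ennreal_le_iff) auto
  then show ?thesis using V_pos[OF r, of a] by (simp add: divide_simps mult_ac)
qed

lemma one_nearD:
  assumes "one_near {x0 :: 'a} u"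
  obtains e where "0 < e" "\<And>x. x \<in> ball x0 e \<Longrightarrow> u x = 1"
proof -
  obtain G where "open G" "x0 \<in> G" and G: "\<forall>x\<in>G. u x = 1" using assms by (auto simp: one_near_def)
  then obtain e where "0 < e" "ball x0 e \<subseteq> G" using open_contains_ball by blast
  then show ?thesis using that G by blast
qed

section \<open>Lower bounds for the two capacities\<close>

text \<open>Energy and L^p term cannot both be small: telescoping forces the average over the unit
  ball up to nearly 3/4, whereas a small L^p norm keeps it near 1/4.\<close>

lemma besov_norm_capacity_pos:
  assumes p: "1 \<le> p" and \<theta>: "0 < \<theta>" and s: "s \<in> upper_S \<nu> x0" "s < \<theta> * p"
  shows "0 < besov_norm_capacity \<nu> \<theta> p {x0}"
proof -
  have p': "0 < p" using p by simp
  obtain M where M: "0 < M" "\<And>u e j. u \<in> borel_measurable \<nu> \<Longrightarrow> (\<And>x. 0 \<le> u x \<and> u x \<le> 1) \<Longrightarrow> 0 < e \<Longrightarrow>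
    (\<And>x. x \<in> ball x0 e \<Longrightarrow> u x = 1) \<Longrightarrow> besov_energy \<nu> \<theta> p u = ennreal j \<Longrightarrow> 0 \<le> j \<Longrightarrow>
    3 / 4 \<le> average u (ball x0 1) + M * j"
    using average_telescope[OF p \<theta> s] by blast
  define M1 where "M1 = (1 / 4) powr (1 - p) / V x0 1"
  have M1: "0 < M1" using V_pos[of 1 x0] by (simp add: M1_def)
  define M2 where "M2 = M + M1"
  have M2: "0 < M2" using M M1 by (simp add: M2_def)
  have "ennreal (1 / (2 * M2)) \<le> besov_norm_capacity \<nu> \<theta> p {x0}"
    unfolding besov_norm_capacity_def besov_seminorm_powr[OF p'] Lp_norm_powr[OF p']
  proof (rule Inf_greatest, safe)
    fix u assume u: "u \<in> borel_measurable \<nu>" "\<forall>x. 0 \<le> u x \<and> u x \<le> 1" "one_near {x0} u"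
      and fin: "besov_energy \<nu> \<theta> p u + (\<integral>\<^sup>+x. ennreal (\<bar>u x\<bar> powr p) \<partial>\<nu>) < \<infinity>"
    obtain j where j: "besov_energy \<nu> \<theta> p u = ennreal j" "0 \<le> j"
      using fin by (cases "besov_energy \<nu> \<theta> p u") auto
    obtain n where n: "(\<integral>\<^sup>+x. ennreal (\<bar>u x\<bar> powr p) \<partial>\<nu>) = ennreal n" "0 \<le> n"
      using fin by (cases "\<integral>\<^sup>+x. ennreal (\<bar>u x\<bar> powr p) \<partial>\<nu>") auto
    obtain e where e: "0 < e" "\<And>x. x \<in> ball x0 e \<Longrightarrow> u x = 1" using one_nearD[OF u(3)] by blast
    have "3 / 4 \<le> average u (ball x0 1) + M * j" by (rule M(2)[where e = e]) (use u e j in auto)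
    moreover have "average u (ball x0 1) \<le> 1 / 4 + M1 * n"
      unfolding M1_def using u by (intro average_le_Lp p n) auto
    ultimately have "1 / 2 \<le> M * j + M1 * n" by simp
    also have "\<dots> \<le> M2 * (j + n)"
      using M(1) M1 j(2) n(2) by (simp add: M2_def distrib_left distrib_right)
    finally have "1 / (2 * M2) \<le> j + n" using M2 by (simp add: divide_simps mult_ac)
    then show "ennreal (1 / (2 * M2)) \<le> besov_energy \<nu> \<theta> p u + (\<integral>\<^sup>+x. ennreal (\<bar>u x\<bar> powr p) \<partial>\<nu>)"
      using j n by (simp add: ennreal_plus[symmetric] ennreal_leI del: ennreal_plus)
  qed
  moreover have "0 < ennreal (1 / (2 * M2))" using M2 by simp
  ultimately show ?thesis by (rule less_le_trans[rotated])
qed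

text \<open>The role of the L^p term is taken by a ball around \<open>z\<close>, outside the
  condenser, where every admissible function vanishes; comparing averages there and on the unit ball
  costs energy.\<close>

lemma besov_condenser_capacity_pos:
  assumes p: "1 \<le> p" and \<theta>: "0 < \<theta>" and s: "s \<in> upper_S \<nu> x0" "s < \<theta> * p"
    and z: "R < dist x0 z"
  shows "0 < besov_condenser_capacity \<nu> \<theta> p {x0} (ball x0 R)"
proof -
  have p': "0 < p" using p by simp
  obtain M where M: "0 < M" "\<And>u e j. u \<in> borel_measurable \<nu> \<Longrightarrow> (\<And>x. 0 \<le> u x \<and> u x \<le> 1) \<Longrightarrow> 0 < e \<Longrightarrow>
    (\<And>x. x \<in> ball x0 e \<Longrightarrow> u x = 1) \<Longrightarrow> besov_energy \<nu> \<theta> p u = ennreal j \<Longrightarrow> 0 \<le> j \<Longrightarrow>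
    3 / 4 \<le> average u (ball x0 1) + M * j"
    using average_telescope[OF p \<theta> s] by blast
  \<comment> \<open>By the triangle inequality \<open>ball z \<delta>\<close> is disjoint from
    \<open>ball x0 R\<close>.\<close>
  define \<delta> where "\<delta> = dist x0 z - R"
  define K where "K = dist x0 z + \<bar>\<delta>\<bar> + 1"
  have \<delta>: "0 < \<delta>" using z by (simp add: \<delta>_def)
  have sub: "ball x0 1 \<subseteq> ball x0 K" "ball z \<delta> \<subseteq> ball x0 K"
  proof -
    show "ball x0 1 \<subseteq> ball x0 K" by (intro subset_ball) (simp add: K_def)
    show "ball z \<delta> \<subseteq> ball x0 K"
    proof
      fix y assume "y \<in> ball z \<delta>"
      then show "y \<in> ball x0 K" using dist_triangle[of x0 y z] by (simp add: K_def)
    qed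
  qed
  define M1 where "M1 = (1 / 4) powr (1 - p) * ((2 * K) powr (\<theta> * p) * V x0 (3 * K)) / (V x0 1 * V z \<delta>)"
  have M1: "0 \<le> M1" by (simp add: M1_def)
  define M2 where "M2 = M + M1"
  have M2: "0 < M2" using M M1 by (simp add: M2_def)
  have "ennreal (1 / (2 * M2)) \<le> besov_condenser_capacity \<nu> \<theta> p {x0} (ball x0 R)"
    unfolding besov_condenser_capacity_def besov_seminorm_powr[OF p']
  proof (rule Inf_greatest, safe)
    fix u assume u: "u \<in> borel_measurable \<nu>" "\<forall>x. 0 \<le> u x \<and> u x \<le> 1" "one_near {x0} u"
      and supp: "supp u \<Subset> ball x0 R"
    show "ennreal (1 / (2 * M2)) \<le> besov_energy \<nu> \<theta> p u"
    proof (cases "besov_energy \<nu> \<theta> p u")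
      case j: (real j)
      obtain e where e: "0 < e" "\<And>x. x \<in> ball x0 e \<Longrightarrow> u x = 1" using one_nearD[OF u(3)] by blast
      have zero: "u y = 0" if "y \<in> ball z \<delta>" for y
      proof (rule ccontr)
        assume "u y \<noteq> 0"
        then have "y \<in> supp u" using closure_subset[of "{x. u x \<noteq> 0}"] by (auto simp: supp_def)
        then have "y \<in> ball x0 R" using supp closure_subset[of "supp u"] by (auto simp: compactly_inside_def)
        then show False using that dist_triangle[of x0 z y] by (simp add: \<delta>_def dist_commute)
      qed
      have "3 / 4 \<le> average u (ball x0 1) + M * j" by (rule M(2)[where e = e]) (use u e j in auto)
      moreover have "average u (ball x0 1) \<le> average u (ball z \<delta>) + (1 / 4 + M1 * j)"
        unfolding M1_def using u \<delta> by (intro average_le_average p \<theta> sub j) auto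
      moreover have "average u (ball z \<delta>) = 0" by (intro average_eq_0 zero)
      ultimately have "1 / 2 \<le> M2 * j" by (simp add: M2_def distrib_right)
      then have "1 / (2 * M2) \<le> j" using M2 by (simp add: divide_simps mult_ac)
      then show ?thesis using j by (simp add: ennreal_leI)
    qed simp
  qed
  moreover have "0 < ennreal (1 / (2 * M2))" using M2 by simp
  ultimately show ?thesis by (rule less_le_trans[rotated])
qed

end

section \<open>Assembly of the two cases\<close>

theorem theorem1p3:
  fixes \<nu> :: "'a::complete_space measure" and x0 :: 'a and p \<theta> :: real
  assumes two_points: "\<exists>a b :: 'a. a \<noteq> b"
    and doubling: "doubling_measure \<nu>"
    and perfect: "uniformly_perfect_at x0"
    and p: "1 \<le> p"
    and theta: "0 < \<theta>" "\<theta> < 1"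
  shows "(upper_s \<nu> x0 < ereal (\<theta> * p) \<longrightarrow>
            0 < besov_norm_capacity \<nu> \<theta> p {x0} \<and>
            (\<forall>R. 0 < R \<and> ereal R < ediameter (UNIV :: 'a set) / 2 \<longrightarrow>
                 0 < besov_condenser_capacity \<nu> \<theta> p {x0} (ball x0 R)))
       \<and> (ereal (\<theta> * p) < upper_s \<nu> x0 \<longrightarrow> \<theta> * p \<notin> upper_S \<nu> x0)
       \<and> (\<theta> * p \<notin> upper_S \<nu> x0 \<or> (1 < p \<and> \<theta> * p \<in> lower_S \<nu> x0) \<longrightarrow>
            besov_norm_capacity \<nu> \<theta> p {x0} = 0 \<and>
            (\<forall>R>0. besov_condenser_capacity \<nu> \<theta> p {x0} (ball x0 R) = 0))"
proof -
  obtain C where ds: "doubling_space \<nu> C"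
  proof -
    obtain C where C: "1 < C" "\<forall>x r. 0 < r \<longrightarrow> measure \<nu> (ball x (2 * r)) \<le> C * measure \<nu> (ball x r)"
      using doubling by (auto simp: doubling_measure_def)
    have "doubling_space \<nu> C"
      using doubling C by unfold_locales (auto simp: doubling_measure_def borel_measure_pos_balls_def)
    then show ?thesis by (rule that)
  qed
  interpret doubling_space \<nu> C by (rule ds)
  show ?thesis
  proof (intro conjI impI)
    assume "upper_s \<nu> x0 < ereal (\<theta> * p)"
    \<comment> \<open>An exponent strictly below \<open>\<theta> * p\<close> provides the gap on
      which the geometric summation rests.\<close>
    then obtain s where s: "s \<in> upper_S \<nu> x0" "s < \<theta> * p"
      by (auto simp: upper_s_def Inf_less_iff)
    show "0 < besov_norm_capacity \<nu> \<theta> p {x0}" by (rule besov_norm_capacity_pos[OF p theta(1) s])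
    show "\<forall>R. 0 < R \<and> ereal R < ediameter (UNIV :: 'a set) / 2 \<longrightarrow>
                 0 < besov_condenser_capacity \<nu> \<theta> p {x0} (ball x0 R)"
    proof (intro allI impI)
      fix R assume R: "0 < R \<and> ereal R < ediameter (UNIV :: 'a set) / 2"
      \<comment> \<open>If all points were within \<open>R\<close> of \<open>x0\<close>, the
        diameter would be at most \<open>2 * R\<close>; the argument covers infinite diameter as
        well.\<close>
      have "\<exists>z. R < dist x0 z"
      proof (rule ccontr)
        assume "\<not> (\<exists>z. R < dist x0 z)"
        then have le: "dist x0 z \<le> R" for z by (simp add: not_less)
        have "dist x y \<le> 2 * R" for x y :: 'a
          using dist_triangle[of x y x0] le[of x] le[of y] by (simp add: dist_commute)
        then have "ediameter (UNIV :: 'a set) \<le> ereal (2 * R)"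
          unfolding ediameter_def by (intro SUP_least) simp
        then have "ediameter (UNIV :: 'a set) / 2 \<le> ereal (2 * R) / 2"
          by (intro ereal_divide_right_mono) auto
        also have "ereal (2 * R) / 2 = ereal R" by auto
        finally show False using R by (meson leD)
      qed
      then show "0 < besov_condenser_capacity \<nu> \<theta> p {x0} (ball x0 R)"
        using besov_condenser_capacity_pos[OF p theta(1) s] by blast
    qed
  next
    assume lt: "ereal (\<theta> * p) < upper_s \<nu> x0"
    show "\<theta> * p \<notin> upper_S \<nu> x0"
    proof
      assume "\<theta> * p \<in> upper_S \<nu> x0"
      then have "upper_s \<nu> x0 \<le> ereal (\<theta> * p)" unfolding upper_s_def by (intro Inf_lower) simp
      then show False using lt by simp
    qed
  next
    assume "\<theta> * p \<notin> upper_S \<nu> x0 \<or> (1 < p \<and> \<theta> * p \<in> lower_S \<nu> x0)"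
    then have small: "\<exists>r \<rho>. 0 < \<rho> \<and> \<rho> < r \<and> r < R \<and>
      besov_energy \<nu> \<theta> p (log_cutoff x0 r \<rho>) \<le> ennreal e \<and> measure \<nu> (ball x0 r) \<le> e"
      if "0 < R" "0 < e" for R e
      using small_energy_not_upper_S[OF p theta _ that] small_energy_lower_S[OF _ theta _ that] by blast
    show "besov_norm_capacity \<nu> \<theta> p {x0} = 0"
      by (rule besov_capacities_eq_0(1)[OF ds p small])
    show "\<forall>R>0. besov_condenser_capacity \<nu> \<theta> p {x0} (ball x0 R) = 0"
      using besov_capacities_eq_0(2)[OF ds p small] by blast
  qed
qed

end
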